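(* For every integer $n\ge20$ there exists a probability measure $\mu$ on $2^{[n]}$ that is CNA+ (and in particular Rayleigh) but not ULC. In other words, for every $n\ge 20$ neither CNA+ nor the Rayleigh property implies ultra log-concavity of the rank sequence.
   Context: Notation: $[n]=\{1,\dots,n\}$; the generating polynomial of a probability measure $\mu$ on $2^{[n]}$ is $g_\mu(z_1,\dots,z_n)=\sum_{S\subseteq[n]}\mu(S)\prod_{i\in S}z_i$. Rank sequence and ULC: the rank sequence of $\mu$ is $r_k=\mu(\{S:|S|=k\})$, $0\le k\le n$. A non-negative sequence $\{a_k\}_{k=0}^n$ is LC if $a_k^2\ge a_{k-1}a_{k+1}$ for $1\le k\le n-1$ and the indices of its nonzero terms form an interval of integers. $\mu$ is ULC if the sequence $\{r_k/\binom nk\}_{k=0}^n$ is LC. Rayleigh: $\frac{\partial g_\mu}{\partial z_i}(x)\frac{\partial g_\mu}{\partial z_j}(x)\ge\frac{\partial^2g_\mu}{\partial z_i\partial z_j}(x)\,g_\mu(x)$ for all $x\in(0,\infty)^n$, $1\le i,j\le n$. CNA+: let $X_i(S)=1$ if $i\in S$ and $0$ otherwise. $\mu$ is NA if $\int F\,d\mu\int G\,d\mu\ge\int FG\,d\mu$ for all increasing functions $F,G$ on $2^{[n]}$ depending on disjoint sets of coordinates; CNA if each measure obtained from $\mu$ by conditioning on some (or none) of the values of the variables $X_i$ (on events of positive probability) is NA; CNA+ if each measure obtained from $\mu$ by imposing external fields and projections is CNA. Here imposing the external field $(a_1,\dots,a_n)$, $a_i\ge0$, gives the measure with generating polynomial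 $g_\mu(a_1z_1,\dots,a_nz_n)/g_\mu(a_1,\dots,a_n)$ (when the denominator is nonzero), and projection onto $2^{S}$ sets $z_i=1$ for $i\notin S$. *)

theory Defs
  imports "HOL-Probability.Probability"
begin

definition measure_on :: "'a set \<Rightarrow> 'a set pmf \<Rightarrow> bool" where
  "measure_on E \<mu> \<longleftrightarrow> set_pmf \<mu> \<subseteq> Pow E"

text \<open>
  Polynomials in the variables indexed by \<open>E\<close> are represented by the functions they define on
  real points; only the coordinates in \<open>E\<close> of a point matter.
\<close>

definition gen_poly :: "'a set \<Rightarrow> 'a set pmf \<Rightarrow> ('a \<Rightarrow> real) \<Rightarrow> real" where
  "gen_poly E \<mu> z = (\<Sum>S\<in>Pow E. pmf \<mu> S * (\<Prod>i\<in>S. z i))"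

definition partial_deriv :: "'a \<Rightarrow> (('a \<Rightarrow> real) \<Rightarrow> real) \<Rightarrow> ('a \<Rightarrow> real) \<Rightarrow> real" where
  "partial_deriv i f x = deriv (\<lambda>t. f (x(i := t))) (x i)"


definition rank_seq :: "'a set \<Rightarrow> 'a set pmf \<Rightarrow> nat \<Rightarrow> real" where
  "rank_seq E \<mu> k = measure_pmf.prob \<mu> {S. S \<subseteq> E \<and> card S = k}"

definition log_concave_seq :: "nat \<Rightarrow> (nat \<Rightarrow> real) \<Rightarrow> bool" where
  "log_concave_seq n a \<longleftrightarrow>
     (\<forall>k\<le>n. 0 \<le> a k) \<and>
     (\<forall>k. 1 \<le> k \<and> k + 1 \<le> n \<longrightarrow> (a k)\<^sup>2 \<ge> a (k - 1) * a (k + 1)) \<and>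
     (\<forall>i j k. i \<le> j \<and> j \<le> k \<and> k \<le> n \<and> a i \<noteq> 0 \<and> a k \<noteq> 0 \<longrightarrow> a j \<noteq> 0)"

definition ULC :: "'a set \<Rightarrow> 'a set pmf \<Rightarrow> bool" where
  "ULC E \<mu> \<longleftrightarrow> log_concave_seq (card E) (\<lambda>k. rank_seq E \<mu> k / real (card E choose k))"


definition Rayleigh :: "'a set \<Rightarrow> 'a set pmf \<Rightarrow> bool" where
  "Rayleigh E \<mu> \<longleftrightarrow>
     (\<forall>x. (\<forall>i\<in>E. 0 < x i) \<longrightarrow>
        (\<forall>i\<in>E. \<forall>j\<in>E.
           partial_deriv i (gen_poly E \<mu>) x * partial_deriv j (gen_poly E \<mu>) x
             \<ge> partial_deriv i (partial_deriv j (gen_poly E \<mu>)) x * gen_poly E \<mu> x))"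


definition depends_on :: "'a set \<Rightarrow> ('a set \<Rightarrow> real) \<Rightarrow> 'a set \<Rightarrow> bool" where
  "depends_on E F A \<longleftrightarrow> (\<forall>S\<subseteq>E. \<forall>T\<subseteq>E. S \<inter> A = T \<inter> A \<longrightarrow> F S = F T)"

definition NA :: "'a set \<Rightarrow> 'a set pmf \<Rightarrow> bool" where
  "NA E \<mu> \<longleftrightarrow>
     (\<forall>F G A B. mono_on (Pow E) F \<and> mono_on (Pow E) G \<and>
        A \<subseteq> E \<and> B \<subseteq> E \<and> A \<inter> B = {} \<and> depends_on E F A \<and> depends_on E G B \<longrightarrow>
        measure_pmf.expectation \<mu> F * measure_pmf.expectation \<mu> G
          \<ge> measure_pmf.expectation \<mu> (\<lambda>S. F S * G S))"

text \<open>
  Here the values \<open>v i\<close> of the variables \<open>X\<^sub>i\<close> with \<open>i \<in> C\<close> are prescribed; \<open>C = {}\<close> is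
  conditioning on nothing. A conditioned measure is kept on the full ground set \<open>E\<close>, its
  coordinates in \<open>C\<close> being almost surely constant.
\<close>

definition cond_event :: "'a set \<Rightarrow> ('a \<Rightarrow> bool) \<Rightarrow> 'a set set" where
  "cond_event C v = {S. \<forall>i\<in>C. i \<in> S \<longleftrightarrow> v i}"

definition CNA :: "'a set \<Rightarrow> 'a set pmf \<Rightarrow> bool" where
  "CNA E \<mu> \<longleftrightarrow>
     (\<forall>C v. C \<subseteq> E \<and> measure_pmf.prob \<mu> (cond_event C v) > 0 \<longrightarrow>
        NA E (cond_pmf \<mu> (cond_event C v)))"

text \<open>
  External fields and projections are given by their effect on generating polynomials. The lemmas
  below show that the resulting measure exists and is unique.
\<close>

definition is_external_field ::
    "'a set \<Rightarrow> ('a \<Rightarrow> real) \<Rightarrow> 'a set pmf \<Rightarrow> 'a set pmf \<Rightarrow> bool" where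
  "is_external_field E a \<mu> \<nu> \<longleftrightarrow>
     (\<forall>i\<in>E. 0 \<le> a i) \<and> gen_poly E \<mu> a \<noteq> 0 \<and> measure_on E \<nu> \<and>
     (\<forall>z. gen_poly E \<nu> z = gen_poly E \<mu> (\<lambda>i. a i * z i) / gen_poly E \<mu> a)"

definition is_projection ::
    "'a set \<Rightarrow> 'a set \<Rightarrow> 'a set pmf \<Rightarrow> 'a set pmf \<Rightarrow> bool" where
  "is_projection E S \<mu> \<nu> \<longleftrightarrow>
     S \<subseteq> E \<and> measure_on S \<nu> \<and>
     (\<forall>z. gen_poly S \<nu> z = gen_poly E \<mu> (\<lambda>i. if i \<in> S then z i else 1))"

text \<open>
  \<open>obtained E \<mu> E' \<nu>\<close>: the measure \<open>\<nu>\<close> on subsets of \<open>E'\<close> arises from the measure \<open>\<mu>\<close> on subsets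
  of \<open>E\<close> by finitely many external fields and projections, in any order.
\<close>

inductive obtained :: "'a set \<Rightarrow> 'a set pmf \<Rightarrow> 'a set \<Rightarrow> 'a set pmf \<Rightarrow> bool"
  for E :: "'a set" and \<mu> :: "'a set pmf" where
  base: "obtained E \<mu> E \<mu>"
| external_field: "obtained E \<mu> E' \<nu> \<Longrightarrow> is_external_field E' a \<nu> \<nu>' \<Longrightarrow> obtained E \<mu> E' \<nu>'"
| projection: "obtained E \<mu> E' \<nu> \<Longrightarrow> is_projection E' S \<nu> \<nu>' \<Longrightarrow> obtained E \<mu> S \<nu>'"

definition CNA_plus :: "'a set \<Rightarrow> 'a set pmf \<Rightarrow> bool" where
  "CNA_plus E \<mu> \<longleftrightarrow> (\<forall>E' \<nu>. obtained E \<mu> E' \<nu> \<longrightarrow> CNA E' \<nu>)"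


lemma gen_poly_inject:
  fixes \<mu> \<nu> :: "'a set pmf"
  assumes "finite E" "measure_on E \<mu>" "measure_on E \<nu>"
    and eq: "\<And>z. gen_poly E \<mu> z = gen_poly E \<nu> z"
  shows "\<mu> = \<nu>"
proof -
  have ind: "gen_poly E \<rho> (indicator T) = (\<Sum>S\<in>Pow T. pmf \<rho> S)"
    if "T \<subseteq> E" for T and \<rho> :: "'a set pmf"
  proof -
    have "pmf \<rho> S * (\<Prod>i\<in>S. indicator T i) = 0" if "S \<in> Pow E - Pow T" for S
    proof -
      have "finite S" using that assms(1) finite_subset by blast
      then show ?thesis using that by (auto simp: indicator_def)
    qed
    then have "gen_poly E \<rho> (indicator T)
        = (\<Sum>S\<in>Pow T. pmf \<rho> S * (\<Prod>i\<in>S. indicator T i))"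
      unfolding gen_poly_def using \<open>T \<subseteq> E\<close> assms(1)
      by (intro sum.mono_neutral_right) auto
    also have "\<dots> = (\<Sum>S\<in>Pow T. pmf \<rho> S)"
      by (intro sum.cong refl) (auto simp: indicator_def subset_iff intro!: prod.neutral)
    finally show ?thesis .
  qed
  have pmf_eq: "pmf \<mu> T = pmf \<nu> T" if "T \<subseteq> E" for T
  proof -
    have "finite T" using that assms(1) finite_subset by blast
    then show ?thesis using that
    proof (induction T rule: finite_psubset_induct)
      case (psubset T)
      have fin: "finite (Pow T)" using psubset.hyps by simp
      have "(\<Sum>S\<in>Pow T. pmf \<mu> S) = (\<Sum>S\<in>Pow T. pmf \<nu> S)"
        using ind[OF psubset.prems] eq by metis
      moreover have "(\<Sum>S\<in>Pow T - {T}. pmf \<mu> S) = (\<Sum>S\<in>Pow T - {T}. pmf \<nu> S)"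
        by (intro sum.cong refl psubset.IH) (use psubset.prems in auto)
      ultimately show ?case
        using sum.remove[OF fin, of T "pmf \<mu>"] sum.remove[OF fin, of T "pmf \<nu>"] by simp
    qed
  qed
  show ?thesis
  proof (rule pmf_eqI)
    fix T
    show "pmf \<mu> T = pmf \<nu> T"
    proof (cases "T \<subseteq> E")
      case False
      then have "T \<notin> set_pmf \<mu>" "T \<notin> set_pmf \<nu>"
        using assms(2,3) by (auto simp: measure_on_def)
      then show ?thesis by (simp add: set_pmf_iff)
    qed (rule pmf_eq)
  qed
qed

lemma external_field_exists:
  assumes "finite E" "\<forall>i\<in>E. 0 \<le> a i" "gen_poly E \<mu> a \<noteq> 0"
  shows "\<exists>\<nu>. is_external_field E a \<mu> \<nu>"
proof -
  define f where
    "f S = (if S \<in> Pow E then pmf \<mu> S * (\<Prod>i\<in>S. a i) / gen_poly E \<mu> a else 0)" for S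
  have nn: "0 \<le> pmf \<mu> S * (\<Prod>i\<in>S. a i)" if "S \<in> Pow E" for S
    using that assms(2) by (intro mult_nonneg_nonneg prod_nonneg) auto
  have "0 \<le> gen_poly E \<mu> a" unfolding gen_poly_def by (intro sum_nonneg nn)
  then have f_nn: "0 \<le> f S" for S
    using nn by (auto simp: f_def)
  have f_sum: "(\<Sum>S\<in>Pow E. f S) = 1"
    using assms(3) by (simp add: f_def gen_poly_def flip: sum_divide_distrib)
  have "(\<integral>\<^sup>+S. ennreal (f S) \<partial>count_space UNIV) = (\<Sum>S\<in>Pow E. ennreal (f S))"
    using assms(1) by (intro nn_integral_count_space') (auto simp: f_def)
  also have "\<dots> = 1" using f_nn f_sum by (simp add: sum_ennreal)
  finally have pmf_f: "pmf (embed_pmf f) S = f S" for S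
    using f_nn by (intro pmf_embed_pmf) auto
  have "measure_on E (embed_pmf f)"
    by (auto simp: measure_on_def set_pmf_iff pmf_f f_def split: if_splits)
  moreover have "gen_poly E (embed_pmf f) z = gen_poly E \<mu> (\<lambda>i. a i * z i) / gen_poly E \<mu> a" for z
    unfolding gen_poly_def[of E "embed_pmf f"] gen_poly_def[of E \<mu> "\<lambda>i. a i * z i"] pmf_f
    by (simp add: f_def sum_divide_distrib prod.distrib mult.assoc)
  ultimately show ?thesis using assms(2,3) unfolding is_external_field_def by blast
qed

lemma is_projection_map_pmf:
  assumes "finite E" "measure_on E \<mu>" "S \<subseteq> E"
  shows "is_projection E S \<mu> (map_pmf (\<lambda>T. T \<inter> S) \<mu>)"
proof -
  have gen: "gen_poly A \<rho> z = measure_pmf.expectation \<rho> (\<lambda>T. \<Prod>i\<in>T. z i)"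
    if "finite A" "measure_on A \<rho>" for A :: "'a set" and \<rho> z
    unfolding gen_poly_def using that
    by (subst integral_measure_pmf_real[where A = "Pow A"]) (auto simp: measure_on_def mult.commute)
  have on: "measure_on S (map_pmf (\<lambda>T. T \<inter> S) \<mu>)" by (auto simp: measure_on_def)
  have "gen_poly S (map_pmf (\<lambda>T. T \<inter> S) \<mu>) z
      = gen_poly E \<mu> (\<lambda>i. if i \<in> S then z i else 1)" for z
  proof -
    have "(\<Prod>i\<in>T \<inter> S. z i) = (\<Prod>i\<in>T. if i \<in> S then z i else 1)" if "T \<in> set_pmf \<mu>" for T
    proof -
      have "T \<subseteq> E" using that assms(2) by (auto simp: measure_on_def)
      then have "finite T" using assms(1) finite_subset by blast
      then show ?thesis by (simp add: prod.inter_restrict)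
    qed
    then have "measure_pmf.expectation \<mu> (\<lambda>T. \<Prod>i\<in>T \<inter> S. z i)
        = measure_pmf.expectation \<mu> (\<lambda>T. \<Prod>i\<in>T. if i \<in> S then z i else 1)"
      by (intro integral_cong_AE) (auto simp: AE_measure_pmf_iff)
    then show ?thesis
      using gen[OF _ on] gen[OF assms(1,2)] finite_subset[OF assms(3,1)] by simp
  qed
  then show ?thesis using assms(3) on by (auto simp: is_projection_def)
qed

end

theory Submission
  imports Defs
begin

text \<open>
  Take measures that are exchangeable in all coordinates but one, \<open>s\<close>, up to an external field: the
  weight of \<open>S\<close> is a product of field factors times \<open>a\<^sub>k\<close> if \<open>s \<notin> S\<close> and \<open>b\<^sub>k\<close> if \<open>s \<in> S\<close>, where
  \<open>k = |S - {s}|\<close>. Suppose that every nonnegative combination of \<open>a\<close> and \<open>b\<close> is log-concave and that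
  \<open>b\<^sub>k / a\<^sub>k\<close> decreases. These conditions survive fields, conditioning, and projection, which replaces
  \<open>c\<^sub>k\<close> by \<open>\<beta> c\<^sub>k + \<alpha> c\<^sub>k\<^sub>+\<^sub>1\<close>, so CNA+ reduces to NA. Let \<open>F\<close> depend on \<open>s\<close> and the coordinates in \<open>A\<close>,
  and \<open>G\<close> on those in \<open>B\<close>; let \<open>x = 1\<close> or \<open>0\<close> as \<open>s\<close> is present or not, and let \<open>K\<close>, \<open>L\<close> be the numbers
  of elements in \<open>A\<close>, \<open>B\<close>. By Efron's theorem \<open>F\<close> and \<open>G\<close> may be replaced by increasing functions of
  \<open>(K, x)\<close> and of \<open>L\<close>. Given \<open>L = l\<close>, the pair \<open>(K, x)\<close> is stochastically decreasing in \<open>l\<close>,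
  so Chebyshev's inequality applies. Rayleigh is the case of two coordinate functions under arbitrary
  fields.

  Normalised by binomial coefficients, the rank sequence is proportional to \<open>(n - k) a\<^sub>k + k b\<^sub>k\<^sub>-\<^sub>1\<close>. It
  fails to be log-concave at \<open>k = \<lfloor>n / 2\<rfloor>\<close> when \<open>a = (1, 2, 4)\<close> on \<open>k - 1, k, k + 1\<close> and
  \<open>b = (2, 2, 2)\<close> on \<open>k - 2, k - 1, k\<close>.
\<close>

subsection \<open>Log-concave sequences\<close>

text \<open>
  Cross-multiplied with arbitrary \<open>k \<le> l\<close>, so that internal zeros are excluded as well.
\<close>

definition strongly_lc :: "(nat \<Rightarrow> real) \<Rightarrow> bool" where
  "strongly_lc c \<longleftrightarrow> (\<forall>k. 0 \<le> c k) \<and> (\<forall>k l. k \<le> l \<longrightarrow> c k * c (Suc l) \<le> c (Suc k) * c l)"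

text \<open>Each use of the definition raises one index and lowers the other by one; after
  \<open>d\<close> uses, \<open>i\<close> and \<open>j + d\<close> have become \<open>i + d\<close>
  and \<open>j\<close>.\<close>

lemma strongly_lc_shift:
  assumes "strongly_lc c" "i \<le> j"
  shows "c i * c (j + d) \<le> c (i + d) * c j"
  using assms(2)
proof (induction d arbitrary: i)
  case (Suc d)
  show ?case
  proof (cases "i = j")
    case False
    have "c i * c (j + Suc d) \<le> c (Suc i) * c (j + d)"
      using assms(1) Suc.prems by (auto simp: strongly_lc_def)
    also have "\<dots> \<le> c (Suc i + d) * c j"
      using Suc.IH[of "Suc i"] Suc.prems False by simp
    finally show ?thesis by simp
  qed (simp add: mult.commute)
qed simp

text \<open>This is the effect of summing out an element with weight \<open>x\<close> when absent
  and \<open>y\<close> when present. Among the mixed terms one product occurs on both sides and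
  cancels; the other is a shift by two.\<close>

lemma strongly_lc_project:
  assumes c: "strongly_lc c" and "0 \<le> x" "0 \<le> y"
  shows "strongly_lc (\<lambda>k. x * c k + y * c (Suc k))"
  unfolding strongly_lc_def
proof (intro conjI allI impI)
  fix k l :: nat assume kl: "k \<le> l"
  have 1: "c k * c (Suc l) \<le> c (Suc k) * c l" "c (Suc k) * c (Suc (Suc l)) \<le> c (Suc (Suc k)) * c (Suc l)"
    using c kl by (auto simp: strongly_lc_def)
  have 2: "c k * c (Suc (Suc l)) \<le> c (Suc (Suc k)) * c l"
    using strongly_lc_shift[OF c kl, of 2] by simp
  have "x^2 * (c k * c (Suc l)) + y^2 * (c (Suc k) * c (Suc (Suc l))) + x * y * (c k * c (Suc (Suc l)))
     \<le> x^2 * (c (Suc k) * c l) + y^2 * (c (Suc (Suc k)) * c (Suc l)) + x * y * (c (Suc (Suc k)) * c l)"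
    using 1 2 assms by (intro add_mono mult_left_mono) auto
  then show "(x * c k + y * c (Suc k)) * (x * c (Suc l) + y * c (Suc (Suc l)))
     \<le> (x * c (Suc k) + y * c (Suc (Suc k))) * (x * c l + y * c (Suc l))"
    by (simp add: algebra_simps power2_eq_square)
qed (use assms in \<open>auto simp: strongly_lc_def\<close>)

text \<open>On generating functions this is multiplication by the variable.\<close>

definition delay :: "(nat \<Rightarrow> real) \<Rightarrow> nat \<Rightarrow> real" where
  "delay c k = (case k of 0 \<Rightarrow> 0 | Suc j \<Rightarrow> c j)"

lemma delay_simps [simp]: "delay c 0 = 0" "delay c (Suc k) = c k"
  by (auto simp: delay_def)

text \<open>Convolution with the two-term sequence \<open>(x, y)\<close>, the effect of adjoining
  one element to a count. The mixed term \<open>c k * c l\<close> is common to both sides; the other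
  is again a shift by two.\<close>

lemma strongly_lc_delay:
  assumes c: "strongly_lc c" and "0 \<le> x" "0 \<le> y"
  shows "strongly_lc (\<lambda>k. x * c k + y * delay c k)"
  unfolding strongly_lc_def
proof (intro conjI allI impI)
  have nn: "0 \<le> delay c k" for k using c by (cases k) (auto simp: strongly_lc_def)
  show "0 \<le> x * c k + y * delay c k" for k
    using nn assms by (auto simp: strongly_lc_def)
  fix k l :: nat assume kl: "k \<le> l"
  have 1: "c k * c (Suc l) \<le> c (Suc k) * c l"
    using c kl by (auto simp: strongly_lc_def)
  have 2: "delay c k * c l \<le> c k * delay c l"
    using kl c by (cases k; cases l) (auto simp: strongly_lc_def)
  have 3: "delay c k * c (Suc l) \<le> c (Suc k) * delay c l"
  proof (cases k)
    case 0 then show ?thesis using c nn by (auto simp: strongly_lc_def)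
  next
    case (Suc k')
    then obtain l' where "l = Suc l'" "k' \<le> l'" using kl by (cases l) auto
    then show ?thesis using strongly_lc_shift[OF c, of k' l' 2] Suc by simp
  qed
  have "x^2 * (c k * c (Suc l)) + y^2 * (delay c k * c l) + x * y * (delay c k * c (Suc l))
     \<le> x^2 * (c (Suc k) * c l) + y^2 * (c k * delay c l) + x * y * (c (Suc k) * delay c l)"
    using 1 2 3 assms by (intro add_mono mult_left_mono) auto
  then show "(x * c k + y * delay c k) * (x * c (Suc l) + y * delay c (Suc l))
     \<le> (x * c (Suc k) + y * delay c (Suc k)) * (x * c l + y * delay c l)"
    by (simp add: algebra_simps power2_eq_square)
qed

section \<open>Chebyshev and layer-cake inequalities for finite sums\<close>

text \<open>Chebyshev's sum inequality for \<open>Q / q\<close> increasing and \<open>R / r\<close>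
  decreasing, cross-multiplied to allow zero denominators. Symmetrising the double sum makes twice
  the difference a sum of products of two determinants that have the same sign.\<close>

lemma chebyshev_sum:
  fixes q Q r R :: "nat \<Rightarrow> real"
  assumes qQ: "\<And>i j. i \<le> j \<Longrightarrow> Q i * q j \<le> q i * Q j"
    and rR: "\<And>i j. i \<le> j \<Longrightarrow> R j * r i \<le> R i * r j"
  shows "(\<Sum>i\<in>I. R i * Q i) * (\<Sum>i\<in>I. r i * q i) \<le> (\<Sum>i\<in>I. R i * q i) * (\<Sum>i\<in>I. r i * Q i)"
proof -
  let ?d = "\<lambda>i j. R i * r j * (q i * Q j - Q i * q j)"
  have eq: "(\<Sum>i\<in>I. R i * q i) * (\<Sum>i\<in>I. r i * Q i) - (\<Sum>i\<in>I. R i * Q i) * (\<Sum>i\<in>I. r i * q i)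
      = (\<Sum>i\<in>I. \<Sum>j\<in>I. ?d i j)"
    unfolding sum_product by (simp add: algebra_simps flip: sum_subtractf)
  have "2 * (\<Sum>i\<in>I. \<Sum>j\<in>I. ?d i j) = (\<Sum>i\<in>I. \<Sum>j\<in>I. ?d i j) + (\<Sum>i\<in>I. \<Sum>j\<in>I. ?d j i)"
    using sum.swap[of ?d I I] by simp
  also have "\<dots> = (\<Sum>i\<in>I. \<Sum>j\<in>I. (R i * r j - R j * r i) * (q i * Q j - Q i * q j))"
    by (simp add: algebra_simps flip: sum.distrib)
  also have "\<dots> \<ge> 0"
  proof (intro sum_nonneg)
    fix i j
    show "0 \<le> (R i * r j - R j * r i) * (q i * Q j - Q i * q j)"
    proof (cases "i \<le> j")
      case True
      then show ?thesis using qQ[OF True] rR[OF True] by simp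
    next
      case False
      then have "j \<le> i" by simp
      from qQ[OF this] rR[OF this] show ?thesis
        by (intro mult_nonpos_nonpos) (auto simp: mult.commute)
    qed
  qed
  finally show ?thesis using eq by linarith
qed

text \<open>Layer-cake decomposition: \<open>f\<close> is a constant plus a nonnegative combination
  of indicators of superlevel sets, and the constant contributes nothing because \<open>m\<close>
  has total mass zero. The induction strips one layer at a time.\<close>

lemma sum_nonneg_if_superlevel_nonneg:
  fixes f m :: "'b \<Rightarrow> real"
  assumes "finite X" "(\<Sum>x\<in>X. m x) = 0"
    and "\<And>v. 0 \<le> (\<Sum>x\<in>{x\<in>X. v < f x}. m x)"
  shows "0 \<le> (\<Sum>x\<in>X. f x * m x)"
  using assms(3)
proof (induction "card (f ` X)" arbitrary: f rule: less_induct)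
  case less
  show ?case
  proof (cases "\<exists>c. \<forall>x\<in>X. f x = c")
    case True
    then obtain c where "\<forall>x\<in>X. f x = c" by blast
    then have "(\<Sum>x\<in>X. f x * m x) = c * (\<Sum>x\<in>X. m x)"
      by (simp add: sum_distrib_left)
    then show ?thesis using assms(2) by simp
  next
    case False
    define M where "M = Max (f ` X)"
    define Y where "Y = f ` X - {M}"
    have ne: "X \<noteq> {}" using False by auto
    have fin: "finite (f ` X)" using assms(1) by simp
    have M: "M \<in> f ` X" "\<And>x. x \<in> X \<Longrightarrow> f x \<le> M"
      using ne fin by (auto simp: M_def)
    obtain x where "x \<in> X" "f x \<noteq> M" using False by blast
    then have "Y \<noteq> {}" by (auto simp: Y_def)
    define w where "w = Max Y"
    have w: "w \<in> Y" "\<And>y. y \<in> Y \<Longrightarrow> y \<le> w"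
      using Max_in[of Y] Max_ge[of Y] \<open>Y \<noteq> {}\<close> fin by (auto simp: w_def Y_def)
    have wM: "w < M" using w(1) M(2) by (force simp: Y_def)
    have wle: "f x \<le> w" if "x \<in> X" "f x \<noteq> M" for x
      using w(2) that by (auto simp: Y_def)
    \<comment> \<open>Capping \<open>f\<close> at its second largest value \<open>w\<close> merges
      the two top levels. What is cut off is \<open>M - w\<close> times the indicator of a
      superlevel set.\<close>
    let ?g = "\<lambda>x. min (f x) w"
    have "?g ` X \<subseteq> Y"
    proof
      fix y assume "y \<in> ?g ` X"
      then obtain x where x: "x \<in> X" "y = min (f x) w" by auto
      then show "y \<in> Y" using wle[of x] w(1) wM by (cases "f x = M") (auto simp: Y_def min_def)
    qed
    then have "card (?g ` X) \<le> card Y" using fin by (intro card_mono) (auto simp: Y_def)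
    also have "card Y < card (f ` X)"
      unfolding Y_def using fin M(1) by (meson card_Diff1_less)
    finally have lt: "card (?g ` X) < card (f ` X)" .
    have g: "0 \<le> (\<Sum>x\<in>X. ?g x * m x)"
    proof (rule less.hyps[OF lt])
      fix v
      show "0 \<le> (\<Sum>x\<in>{x\<in>X. v < ?g x}. m x)"
      proof (cases "v < w")
        case True then show ?thesis using less.prems[of v] by simp
      qed simp
    qed
    have "(\<Sum>x\<in>X. f x * m x) = (\<Sum>x\<in>X. ?g x * m x + (if w < f x then (M - w) * m x else 0))"
    proof (intro sum.cong refl)
      fix x assume "x \<in> X"
      then show "f x * m x = ?g x * m x + (if w < f x then (M - w) * m x else 0)"
        using wle[of x] by (cases "f x = M") (use wM in \<open>auto simp: min_def algebra_simps\<close>)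
    qed
    also have "\<dots> = (\<Sum>x\<in>X. ?g x * m x) + (M - w) * (\<Sum>x\<in>{x\<in>X. w < f x}. m x)"
      using assms(1) by (simp add: sum.distrib sum.If_cases sum_distrib_left Int_def)
    also have "\<dots> \<ge> 0" using g less.prems[of w] wM by (intro add_nonneg_nonneg mult_nonneg_nonneg) auto
    finally show ?thesis .
  qed
qed

section \<open>Compatible pairs of sequences\<close>

text \<open>Fields and conditioning rescale \<open>a\<close> and \<open>b\<close> independently, and
  projecting out the special element adds them; hence log-concavity is asked of all nonnegative
  combinations.\<close>

definition compatible :: "(nat \<Rightarrow> real) \<Rightarrow> (nat \<Rightarrow> real) \<Rightarrow> bool" where
  "compatible a b \<longleftrightarrow> (\<forall>x\<ge>0. \<forall>y\<ge>0. strongly_lc (\<lambda>k. x * a k + y * b k)) \<and>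
     (\<forall>k l. k \<le> l \<longrightarrow> a k * b l \<le> a l * b k)"

lemma compatible_lc:
  assumes "compatible a b"
  shows "strongly_lc a" "strongly_lc b" "strongly_lc (\<lambda>k. a k + b k)"
proof -
  have *: "strongly_lc (\<lambda>k. x * a k + y * b k)" if "0 \<le> x" "0 \<le> y" for x y
    using assms that by (auto simp: compatible_def)
  show "strongly_lc a" "strongly_lc b" "strongly_lc (\<lambda>k. a k + b k)"
    using *[of 1 0] *[of 0 1] *[of 1 1] by auto
qed

lemma compatible_scale:
  assumes "compatible a b" "0 \<le> u" "0 \<le> v"
  shows "compatible (\<lambda>k. u * a k) (\<lambda>k. v * b k)"
  unfolding compatible_def
proof (intro conjI allI impI)
  fix x y :: real assume "0 \<le> x" "0 \<le> y"
  then have "strongly_lc (\<lambda>k. (x * u) * a k + (y * v) * b k)"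
    using assms by (simp add: compatible_def)
  then show "strongly_lc (\<lambda>k. x * (u * a k) + y * (v * b k))" by (simp add: mult.assoc)
next
  fix k l :: nat assume "k \<le> l"
  then have "(u * v) * (a k * b l) \<le> (u * v) * (a l * b k)"
    using assms by (intro mult_left_mono) (auto simp: compatible_def)
  then show "(u * a k) * (v * b l) \<le> (u * a l) * (v * b k)" by (simp add: algebra_simps)
qed

lemma compatible_project:
  assumes "compatible a b" "0 \<le> u" "0 \<le> v"
  shows "compatible (\<lambda>k. u * a k + v * a (Suc k)) (\<lambda>k. u * b k + v * b (Suc k))"
  unfolding compatible_def
proof (intro conjI allI impI)
  fix x y :: real assume "0 \<le> x" "0 \<le> y"
  then have "strongly_lc (\<lambda>k. u * (x * a k + y * b k) + v * (x * a (Suc k) + y * b (Suc k)))"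
    using assms strongly_lc_project[of "\<lambda>k. x * a k + y * b k" u v] by (simp add: compatible_def)
  then show "strongly_lc (\<lambda>k. x * (u * a k + v * a (Suc k)) + y * (u * b k + v * b (Suc k)))"
    by (simp add: algebra_simps)
next
  fix k l :: nat assume kl: "k \<le> l"
  have r: "a i * b j \<le> a j * b i" if "i \<le> j" for i j
    using assms that by (auto simp: compatible_def)
  \<comment> \<open>For \<open>k < l\<close> the terms are compared in pairs, one of which needs
    \<open>Suc k \<le> l\<close>; for \<open>k = l\<close> the two sides coincide.\<close>
  have cross: "a k * b (Suc l) + a (Suc k) * b l \<le> a l * b (Suc k) + a (Suc l) * b k"
  proof (cases "k = l")
    case False
    then show ?thesis using r[of k "Suc l"] r[of "Suc k" l] kl by linarith
  qed simp
  have "u^2 * (a k * b l) \<le> u^2 * (a l * b k)"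
    using r[OF kl] by (intro mult_left_mono) auto
  moreover have "v^2 * (a (Suc k) * b (Suc l)) \<le> v^2 * (a (Suc l) * b (Suc k))"
    using r[of "Suc k" "Suc l"] kl by (intro mult_left_mono) auto
  moreover have "u * v * (a k * b (Suc l) + a (Suc k) * b l)
      \<le> u * v * (a l * b (Suc k) + a (Suc l) * b k)"
    using cross assms by (intro mult_left_mono) auto
  ultimately have "u^2 * (a k * b l) + v^2 * (a (Suc k) * b (Suc l)) + u * v * (a k * b (Suc l) + a (Suc k) * b l)
     \<le> u^2 * (a l * b k) + v^2 * (a (Suc l) * b (Suc k)) + u * v * (a l * b (Suc k) + a (Suc l) * b k)"
    by linarith
  then show "(u * a k + v * a (Suc k)) * (u * b l + v * b (Suc l))
      \<le> (u * a l + v * a (Suc l)) * (u * b k + v * b (Suc k))"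
    by (simp add: algebra_simps power2_eq_square)
qed

text \<open>Summing out the special element adds the two slices. The zero sequence keeps the result
  in the two-sequence form.\<close>

lemma compatible_merge:
  assumes "compatible a b"
  shows "compatible (\<lambda>k. a k + b k) (\<lambda>k. 0)"
  unfolding compatible_def
proof (intro conjI allI impI)
  fix x y :: real assume "0 \<le> x"
  then have "strongly_lc (\<lambda>k. x * a k + x * b k)"
    using assms by (auto simp: compatible_def)
  then show "strongly_lc (\<lambda>k. x * (a k + b k) + y * 0)" by (simp add: algebra_simps)
qed simp

text \<open>Given that \<open>K\<close> lies in \<open>J\<close>, a larger \<open>L\<close> makes
  the special element less likely. In the variable \<open>u = k + d\<close>, the weight translated
  by \<open>l'\<close> relative to the one translated by \<open>l\<close> increases with
  \<open>u\<close> because \<open>p\<close> is log-concave on \<open>J\<close>, while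
  \<open>b u / a u\<close> decreases; Chebyshev's inequality combines the two.\<close>

lemma special_count_anticorrelation:
  assumes ab: "compatible a b" and p: "strongly_lc (\<lambda>k. if k \<in> J then p k else 0)"
    and "finite J" "l \<le> l'"
  shows "(\<Sum>k\<in>J. p k * b (k + l')) * (\<Sum>k\<in>J. p k * a (k + l))
       \<le> (\<Sum>k\<in>J. p k * b (k + l)) * (\<Sum>k\<in>J. p k * a (k + l'))"
proof -
  define pp where "pp k = (if k \<in> J then p k else 0)" for k
  \<comment> \<open>\<open>T d\<close> is \<open>pp\<close> translated by \<open>d\<close>; the
    guard counters the truncated subtraction.\<close>
  define T where "T d u = (if d \<le> u then pp (u - d) else 0)" for d u
  obtain N where N: "J \<subseteq> {..N}" using \<open>finite J\<close> finite_nat_set_iff_bounded_le by auto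
  have lc: "strongly_lc pp" using p by (simp add: pp_def[abs_def])
  have conv: "(\<Sum>k\<in>J. p k * f (k + d)) = (\<Sum>u\<le>N + l'. f u * T d u)" if "d \<le> l'" for d f
  proof -
    have "(\<Sum>k\<in>J. p k * f (k + d)) = (\<Sum>u\<in>(\<lambda>k. k + d) ` J. f u * T d u)"
      by (subst sum.reindex) (auto simp: T_def pp_def inj_on_def intro!: sum.cong)
    also have "\<dots> = (\<Sum>u\<le>N + l'. f u * T d u)"
    proof (rule sum.mono_neutral_left)
      show "(\<lambda>k. k + d) ` J \<subseteq> {..N + l'}" using N that by auto
      show "\<forall>i\<in>{..N + l'} - (\<lambda>k. k + d) ` J. f i * T d i = 0"
        by (auto simp: T_def pp_def image_iff) (metis le_add_diff_inverse2)
    qed simp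
    finally show ?thesis .
  qed
  have TP: "T l' i * T l j \<le> T l i * T l' j" if "i \<le> j" for i j
  proof (cases "l' \<le> i")
    case True
    have "pp (i - l') * pp (j - l' + (l' - l)) \<le> pp (i - l' + (l' - l)) * pp (j - l')"
      using True that by (intro strongly_lc_shift[OF lc]) auto
    then show ?thesis using True that \<open>l \<le> l'\<close> by (simp add: T_def)
  next
    case False
    have "0 \<le> T d u" for d u using lc by (auto simp: T_def strongly_lc_def)
    then show ?thesis using False by (simp add: T_def)
  qed
  show ?thesis
    unfolding conv[OF order_refl] conv[OF \<open>l \<le> l'\<close>]
  proof (rule chebyshev_sum)
    show "T l' i * T l j \<le> T l i * T l' j" if "i \<le> j" for i j using TP[OF that] .
    show "b j * a i \<le> b i * a j" if "i \<le> j" for i j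
      using ab that by (auto simp: compatible_def mult.commute)
  qed
qed

subsection \<open>Stochastic monotonicity in the number of remaining elements\<close>

text \<open>\<open>H\<close>, \<open>M0 + M1\<close> and \<open>L\<close> are the masses of a high,
  a middle and a low block, the middle one split by \<open>x\<close>; primes mark the larger value
  of the other count. Mass moves to lower blocks and, within the middle one, to
  \<open>x = 0\<close>. The two missing comparisons, \<open>H\<close> with \<open>M0\<close> and
  \<open>M1\<close> with \<open>L\<close>, come from chaining through the total middle mass, which
  is cancelled when nonzero.\<close>

lemma three_block_inequality:
  fixes H M0 M1 L H' M0' M1' L' :: real
  assumes nn: "0 \<le> H" "0 \<le> M0" "0 \<le> M1" "0 \<le> L" "0 \<le> H'" "0 \<le> M0'" "0 \<le> M1'" "0 \<le> L'"
    and HL: "H' * L \<le> H * L'" and HM: "H' * (M0 + M1) \<le> H * (M0' + M1')"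
    and LM: "(M0' + M1') * L \<le> (M0 + M1) * L'" and MM: "M1' * M0 \<le> M1 * M0'"
  shows "(H' + M1') * (H + M0 + M1 + L) \<le> (H + M1) * (H' + M0' + M1' + L')"
proof -
  have 1: "H' * M0 \<le> H * M0'"
  proof (cases "M0 + M1 = 0")
    case True
    then have "M0 = 0" using nn by linarith
    then show ?thesis using nn by simp
  next
    case False
    then have pos: "0 < M0 + M1" using nn by linarith
    have "H' * M0 * (M0 + M1) \<le> H * (M0' + M1') * M0"
      using mult_right_mono[OF HM nn(2)] by (simp add: algebra_simps)
    also have "\<dots> \<le> H * M0' * (M0 + M1)"
      using mult_left_mono[OF MM nn(1)] by (simp add: algebra_simps)
    finally show ?thesis using pos by (simp add: mult_le_cancel_right)
  qed
  have 2: "M1' * L \<le> M1 * L'"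
  proof (cases "M0' + M1' = 0")
    case True
    then have "M1' = 0" using nn by linarith
    then show ?thesis using nn by simp
  next
    case False
    then have pos: "0 < M0' + M1'" using nn by linarith
    have "M1' * L * (M0' + M1') \<le> (M0 + M1) * L' * M1'"
      using mult_right_mono[OF LM nn(7)] by (simp add: algebra_simps)
    also have "\<dots> \<le> M1 * L' * (M0' + M1')"
      using mult_right_mono[OF MM nn(8)] by (simp add: algebra_simps)
    finally show ?thesis using pos by (simp add: mult_le_cancel_right)
  qed
  have "(H + M1) * (H' + M0' + M1' + L') - (H' + M1') * (H + M0 + M1 + L)
      = (H * M0' - H' * M0) + (M1 * L' - M1' * L) + (H * L' - H' * L) + (M1 * M0' - M1' * M0)"
    by (simp add: algebra_simps)
  then show ?thesis using 1 2 HL MM by linarith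
qed

text \<open>
  \<open>U0\<close> and \<open>U1\<close> are the slices \<open>x = 0\<close> and \<open>x = 1\<close> of an up-set of pairs \<open>(K, x)\<close>. They cut \<open>J\<close>
  into three consecutive blocks; only on the middle one does the up-set depend on \<open>x\<close>, and there it
  is the event \<open>x = 1\<close>.
\<close>

lemma superlevel_anticorrelation:
  fixes p a b :: "nat \<Rightarrow> real"
  defines "W \<equiv> \<lambda>f d X. \<Sum>k\<in>X. p k * f (k + d)"
  assumes ab: "compatible a b" and p: "strongly_lc (\<lambda>k. if k \<in> J then p k else 0)"
    and pos: "\<And>k. k \<in> J \<Longrightarrow> 0 < p k" and J: "finite J" and l: "l \<le> l'"
    and U: "U0 \<subseteq> U1" "U1 \<subseteq> J"
    and up0: "\<And>i j. i \<in> U0 \<Longrightarrow> j \<in> J \<Longrightarrow> i \<le> j \<Longrightarrow> j \<in> U0"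
    and up1: "\<And>i j. i \<in> U1 \<Longrightarrow> j \<in> J \<Longrightarrow> i \<le> j \<Longrightarrow> j \<in> U1"
  shows "(W a l' U0 + W b l' U1) * (W a l J + W b l J)
       \<le> (W a l U0 + W b l U1) * (W a l' J + W b l' J)"
proof -
  define Mid Lo where "Mid = U1 - U0" and "Lo = J - U1"
  let ?c = "\<lambda>k. a k + b k"
  note lc = compatible_lc[OF ab]
  have nn: "0 \<le> W f d X" if "X \<subseteq> J" "\<And>k. 0 \<le> f k" for f d X
    unfolding W_def using that by (intro sum_nonneg mult_nonneg_nonneg) (auto intro!: less_imp_le[OF pos])
  have nna: "0 \<le> W a d X" and nnb: "0 \<le> W b d X" if "X \<subseteq> J" for d X
    using that lc by (auto intro!: nn simp: strongly_lc_def)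
  have fin: "finite U0" "finite Mid" "finite Lo"
    using U J by (auto simp: Mid_def Lo_def intro: finite_subset)
  have U1: "W f d U1 = W f d U0 + W f d Mid" for f d
    unfolding W_def Mid_def sum.subset_diff[OF U(1) finite_subset[OF U(2) J]] by (rule add.commute)
  have WJ: "W f d J = W f d U0 + W f d Mid + W f d Lo" for f d
    using U1[of f d] sum.subset_diff[OF U(2) J, of "\<lambda>k. p k * f (k + d)"] unfolding W_def Lo_def by simp
  have Wc: "W ?c d X = W a d X + W b d X" for d X
    by (simp add: W_def distrib_left sum.distrib)
  \<comment> \<open>A block \<open>X\<close> to the left of \<open>Y\<close> gains relative to
    \<open>Y\<close> when \<open>l\<close> is replaced by \<open>l'\<close>: term by term this is
    the shift inequality for \<open>a + b\<close>.\<close>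
  have sep: "W ?c l' Y * W ?c l X \<le> W ?c l Y * W ?c l' X"
    if "X \<subseteq> J" "Y \<subseteq> J" "\<And>i j. i \<in> X \<Longrightarrow> j \<in> Y \<Longrightarrow> i \<le> j" for X Y
    unfolding W_def sum_product
  proof (intro sum_mono)
    fix j i assume ij: "j \<in> Y" "i \<in> X"
    then have "?c (i + l) * ?c (j + l + (l' - l)) \<le> ?c (i + l + (l' - l)) * ?c (j + l)"
      using that(3) by (intro strongly_lc_shift[OF lc(3)]) auto
    then have "?c (j + l') * ?c (i + l) \<le> ?c (j + l) * ?c (i + l')"
      using l by (simp add: mult.commute)
    then have "(p j * p i) * (?c (j + l') * ?c (i + l)) \<le> (p j * p i) * (?c (j + l) * ?c (i + l'))"
      using pos[of i] pos[of j] ij that by (intro mult_left_mono) (auto simp: less_imp_le subset_iff)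
    then show "(p j * ?c (j + l')) * (p i * ?c (i + l)) \<le> (p j * ?c (j + l)) * (p i * ?c (i + l'))"
      by (simp add: algebra_simps)
  qed
  have sub: "Mid \<subseteq> J" "Lo \<subseteq> J" "U0 \<subseteq> J" using U by (auto simp: Mid_def Lo_def)
  have Lo_le: "i \<le> j" if "i \<in> Lo" "j \<in> U1" for i j
    using that up1[of j i] by (auto simp: Lo_def) (meson nle_le)
  have le_U0: "i \<le> j" if "i \<in> J - U0" "j \<in> U0" for i j
    using that up0[of j i] by auto (meson nle_le)
  have HL: "W ?c l' U0 * W ?c l Lo \<le> W ?c l U0 * W ?c l' Lo"
    using sub U Lo_le by (intro sep) auto
  have HM: "W ?c l' U0 * W ?c l Mid \<le> W ?c l U0 * W ?c l' Mid"
    using sub U le_U0 by (intro sep) (auto simp: Mid_def)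
  have LM: "W ?c l' Mid * W ?c l Lo \<le> W ?c l Mid * W ?c l' Lo"
    using sub U Lo_le by (intro sep) (auto simp: Mid_def)
  \<comment> \<open>The middle block is an interval within \<open>J\<close>, so restricting
    \<open>p\<close> to it preserves log-concavity.\<close>
  have lcMid: "strongly_lc (\<lambda>k. if k \<in> Mid then p k else 0)"
    unfolding strongly_lc_def
  proof (intro conjI allI impI)
    fix k show "0 \<le> (if k \<in> Mid then p k else 0)" using pos[of k] sub by auto
  next
    fix k m :: nat assume km: "k \<le> m"
    show "(if k \<in> Mid then p k else 0) * (if Suc m \<in> Mid then p (Suc m) else 0)
       \<le> (if Suc k \<in> Mid then p (Suc k) else 0) * (if m \<in> Mid then p m else 0)"
    proof (cases "k \<in> Mid \<and> Suc m \<in> Mid")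
      case True
      then have kJ: "k \<in> J" "Suc m \<in> J" using sub by auto
      have le: "p k * p (Suc m) \<le> (if Suc k \<in> J then p (Suc k) else 0) * (if m \<in> J then p m else 0)"
        using p[unfolded strongly_lc_def, THEN conjunct2, rule_format, OF km] kJ by (simp split del: if_split)
      \<comment> \<open>A positive left side excludes internal zeros, so both inner indices lie in
        \<open>J\<close>; the up-closure of \<open>U1\<close> and the complement of
        \<open>U0\<close> then place them in \<open>Mid\<close>.\<close>
      have "0 < p k * p (Suc m)" using pos kJ by simp
      then have J': "Suc k \<in> J" "m \<in> J" using le by (auto split: if_splits)
      have "Suc k \<in> Mid"
        using True J' km up1[of k "Suc k"] up0[of "Suc k" "Suc m"] kJ by (auto simp: Mid_def)
      moreover have "m \<in> Mid"
        using True J' km up1[of k m] up0[of m "Suc m"] kJ by (auto simp: Mid_def)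
      ultimately show ?thesis using le J' True by simp
    next
      case False
      have nnM: "0 \<le> (if k \<in> Mid then p k else 0)" for k using pos[of k] sub by auto
      have "(if k \<in> Mid then p k else 0) * (if Suc m \<in> Mid then p (Suc m) else 0) = 0"
        using False by auto
      then show ?thesis using mult_nonneg_nonneg[OF nnM nnM] by (simp only:)
    qed
  qed
  have MM: "W b l' Mid * W a l Mid \<le> W b l Mid * W a l' Mid"
    unfolding W_def by (rule special_count_anticorrelation[OF ab lcMid fin(2) l])
  have "(W ?c l' U0 + W b l' Mid) * (W ?c l U0 + W a l Mid + W b l Mid + W ?c l Lo)
     \<le> (W ?c l U0 + W b l Mid) * (W ?c l' U0 + W a l' Mid + W b l' Mid + W ?c l' Lo)"
    using HL HM LM MM unfolding Wc
    by (intro three_block_inequality) (auto intro!: add_nonneg_nonneg nna nnb sub)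
  moreover have "W ?c l U0 + W a l Mid + W b l Mid + W ?c l Lo = W a l J + W b l J"
    "W ?c l' U0 + W a l' Mid + W b l' Mid + W ?c l' Lo = W a l' J + W b l' J"
    unfolding WJ Wc by simp_all
  moreover have "W ?c l' U0 + W b l' Mid = W a l' U0 + W b l' U1" "W ?c l U0 + W b l Mid = W a l U0 + W b l U1"
    unfolding U1 Wc by simp_all
  ultimately show ?thesis by (simp only:)
qed

text \<open>
  \<open>P0 k\<close> and \<open>P1 k\<close> stand for \<open>p k\<close> times the values at \<open>(k, 0)\<close> and \<open>(k, 1)\<close> of an increasing function;
  the products avoid dividing by \<open>p k = 0\<close>.
\<close>

lemma conditional_expectation_antimono:
  fixes p P0 P1 a b :: "nat \<Rightarrow> real"
  assumes ab: "compatible a b" and p: "strongly_lc p" and l: "l \<le> l'"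
    and supp: "\<And>k. N < k \<Longrightarrow> p k = 0"
    and P0: "\<And>i j. i \<le> j \<Longrightarrow> P0 i * p j \<le> P0 j * p i"
    and P1: "\<And>i j. i \<le> j \<Longrightarrow> P1 i * p j \<le> P1 j * p i"
    and P01: "\<And>k. P0 k \<le> P1 k" and P_zero: "\<And>k. p k = 0 \<Longrightarrow> P0 k = 0 \<and> P1 k = 0"
  shows "(\<Sum>k\<le>N. P0 k * a (k + l') + P1 k * b (k + l')) * (\<Sum>k\<le>N. p k * (a (k + l) + b (k + l)))
       \<le> (\<Sum>k\<le>N. P0 k * a (k + l) + P1 k * b (k + l)) * (\<Sum>k\<le>N. p k * (a (k + l') + b (k + l')))"
proof -
  define J where "J = {k. 0 < p k}"
  have pnn: "0 \<le> p k" for k using p by (simp add: strongly_lc_def)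
  have JN: "J \<subseteq> {..N}" using supp unfolding J_def by (metis less_irrefl mem_Collect_eq atMost_iff not_le subsetI)
  then have J: "finite J" using finite_subset by blast
  have pJ: "(\<lambda>k. if k \<in> J then p k else 0) = p"
    using pnn by (auto simp: J_def fun_eq_iff less_le)
  define f where "f = (\<lambda>(k, x). if x then P1 k / p k else P0 k / p k)"
  let ?X = "J \<times> (UNIV :: bool set)"
  define c where "c x = (if x then b else a)" for x :: bool
  define r where "r d = (\<Sum>k\<le>N. p k * (a (k + d) + b (k + d)))" for d
  \<comment> \<open>The difference of the laws of \<open>(K, x)\<close> given \<open>l\<close> and
    given \<open>l'\<close>, multiplied by both normalising constants. Its total mass is zero, so
    the layer-cake lemma reduces the claim to superlevel sets of \<open>f\<close>.\<close>
  define m where "m = (\<lambda>(k, x). p k * (c x (k + l) * r l' - c x (k + l') * r l))"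
  have restrict: "(\<Sum>k\<le>N. g k) = (\<Sum>k\<in>J. g k)" if "\<And>k. p k = 0 \<Longrightarrow> g k = 0" for g :: "nat \<Rightarrow> real"
    using that pnn JN by (intro sum.mono_neutral_right) (auto simp: J_def less_le)
  have rJ: "r d = (\<Sum>k\<in>J. p k * a (k + d)) + (\<Sum>k\<in>J. p k * b (k + d))" for d
    unfolding r_def by (subst restrict) (auto simp: distrib_left sum.distrib)
  have split: "(\<Sum>z\<in>?X. g z) = (\<Sum>k\<in>J. g (k, False)) + (\<Sum>k\<in>J. g (k, True))" for g :: "nat \<times> bool \<Rightarrow> real"
  proof -
    have "(\<Sum>z\<in>?X. g z) = (\<Sum>k\<in>J. \<Sum>x\<in>UNIV. g (k, x))"
      by (simp add: sum.cartesian_product)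
    then show ?thesis by (simp add: UNIV_bool sum.distrib add.commute)
  qed
  have "0 \<le> (\<Sum>z\<in>?X. f z * m z)"
  proof (rule sum_nonneg_if_superlevel_nonneg)
    show "finite ?X" using J by simp
    show "(\<Sum>z\<in>?X. m z) = 0"
    proof -
      have "(\<Sum>z\<in>?X. m z) = ((\<Sum>k\<in>J. p k * a (k + l)) + (\<Sum>k\<in>J. p k * b (k + l))) * r l'
        - ((\<Sum>k\<in>J. p k * a (k + l')) + (\<Sum>k\<in>J. p k * b (k + l'))) * r l"
        unfolding split m_def c_def
        by (simp add: right_diff_distrib left_diff_distrib distrib_right sum_subtractf sum_distrib_right mult.assoc)
      then show ?thesis unfolding rJ by simp
    qed
  next
    fix v
    \<comment> \<open>The slices of a superlevel set at the two values of \<open>x\<close>.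
      Monotonicity of \<open>f\<close> makes each of them up-closed in \<open>J\<close> and nests
      them.\<close>
    define V where "V x = {k\<in>J. v < f (k, x)}" for x
    have V: "V x \<subseteq> J" for x by (auto simp: V_def)
    have "{z \<in> ?X. v < f z} = V False \<times> {False} \<union> V True \<times> {True}"
      by (auto simp: V_def) (metis (full_types))+
    then have "(\<Sum>z\<in>{z \<in> ?X. v < f z}. m z)
        = (\<Sum>z\<in>V False \<times> {False}. m z) + (\<Sum>z\<in>V True \<times> {True}. m z)"
      using V J finite_subset[OF V J] by (subst sum.union_disjoint[symmetric]) auto
    also have "\<dots> = (\<Sum>k\<in>V False. m (k, False)) + (\<Sum>k\<in>V True. m (k, True))"
    proof -
      have "(\<Sum>z\<in>V x \<times> {x}. m z) = (\<Sum>k\<in>V x. m (k, x))" for x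
        using sum.cartesian_product[of "\<lambda>k x. m (k, x)" "{x}" "V x"] by simp
      then show ?thesis by simp
    qed
    also have "\<dots> = ((\<Sum>k\<in>V False. p k * a (k + l)) + (\<Sum>k\<in>V True. p k * b (k + l))) * r l'
        - ((\<Sum>k\<in>V False. p k * a (k + l')) + (\<Sum>k\<in>V True. p k * b (k + l'))) * r l"
      unfolding m_def c_def
      by (simp add: right_diff_distrib left_diff_distrib distrib_right sum_subtractf sum_distrib_right mult.assoc)
    also have "\<dots> \<ge> 0"
    proof -
      have mono: "f (i, x) \<le> f (j, x)" if "i \<in> J" "j \<in> J" "i \<le> j" for i j x
        using that P0[of i j] P1[of i j] by (auto simp: f_def J_def divide_simps mult.commute)
      have "f (k, False) \<le> f (k, True)" if "k \<in> J" for k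
        using that P01[of k] by (auto simp: f_def J_def divide_right_mono)
      then have sub: "V False \<subseteq> V True" by (force simp: V_def)
      have "((\<Sum>k\<in>V False. p k * a (k + l')) + (\<Sum>k\<in>V True. p k * b (k + l'))) * r l
          \<le> ((\<Sum>k\<in>V False. p k * a (k + l)) + (\<Sum>k\<in>V True. p k * b (k + l))) * r l'"
        unfolding rJ
      proof (rule superlevel_anticorrelation[OF ab _ _ J l sub V])
        show "strongly_lc (\<lambda>k. if k \<in> J then p k else 0)" unfolding pJ by (rule p)
        show "j \<in> V False" if "i \<in> V False" "j \<in> J" "i \<le> j" for i j
          using that mono[of i j False] by (auto simp: V_def)
        show "j \<in> V True" if "i \<in> V True" "j \<in> J" "i \<le> j" for i j
          using that mono[of i j True] by (auto simp: V_def)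
      qed (simp add: J_def)
      then show ?thesis by simp
    qed
    finally show "0 \<le> (\<Sum>z\<in>{z \<in> ?X. v < f z}. m z)" .
  qed
  also have "(\<Sum>z\<in>?X. f z * m z)
      = (\<Sum>k\<in>J. P0 k * (a (k + l) * r l' - a (k + l') * r l)) + (\<Sum>k\<in>J. P1 k * (b (k + l) * r l' - b (k + l') * r l))"
    unfolding split by (intro arg_cong2[where f = "(+)"] sum.cong) (auto simp: f_def m_def c_def J_def)
  also have "\<dots> = (\<Sum>k\<in>J. P0 k * a (k + l) + P1 k * b (k + l)) * r l'
      - (\<Sum>k\<in>J. P0 k * a (k + l') + P1 k * b (k + l')) * r l"
    by (simp add: right_diff_distrib left_diff_distrib distrib_right sum_subtractf sum.distrib sum_distrib_right mult.assoc)
  also have "\<dots> = (\<Sum>k\<le>N. P0 k * a (k + l) + P1 k * b (k + l)) * r l'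
      - (\<Sum>k\<le>N. P0 k * a (k + l') + P1 k * b (k + l')) * r l"
    using P_zero by (subst (1 2) restrict) auto
  finally show ?thesis by (simp add: r_def)
qed

subsection \<open>Efron's theorem for weighted subsets\<close>

text \<open>
  Absent elements carry weights of their own so that conditioning amounts to setting \<open>\<alpha> i\<close> or
  \<open>\<beta> i\<close> to zero, without changing the ground set.
\<close>

definition wt :: "('a \<Rightarrow> real) \<Rightarrow> ('a \<Rightarrow> real) \<Rightarrow> 'a set \<Rightarrow> 'a set \<Rightarrow> real" where
  "wt \<alpha> \<beta> A U = (\<Prod>i\<in>U. \<alpha> i) * (\<Prod>i\<in>A - U. \<beta> i)"

text \<open>For \<open>F = (\<lambda>_. 1)\<close> this is the coefficient of z^k in the product of
  the factors \<beta> i + \<alpha> i z over \<open>A\<close>.\<close>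

definition level ::
    "('a \<Rightarrow> real) \<Rightarrow> ('a \<Rightarrow> real) \<Rightarrow> 'a set \<Rightarrow> ('a set \<Rightarrow> real) \<Rightarrow> nat \<Rightarrow> real" where
  "level \<alpha> \<beta> A F k = (\<Sum>U\<in>Pow A. wt \<alpha> \<beta> A U * (F U * of_bool (card U = k)))"

lemma sum_Pow_insert:
  assumes "finite A" "x \<notin> A"
  shows "(\<Sum>S\<in>Pow (insert x A). h S) = (\<Sum>S\<in>Pow A. h S + h (insert x S))"
proof -
  have inj: "inj_on (insert x) (Pow A)"
    using assms(2) by (auto simp: inj_on_def)
  have "(\<Sum>S\<in>Pow (insert x A). h S) = (\<Sum>S\<in>Pow A. h S) + (\<Sum>S\<in>insert x ` Pow A. h S)"
    unfolding Pow_insert using assms by (intro sum.union_disjoint) auto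
  then show ?thesis by (simp add: sum.reindex[OF inj] sum.distrib)
qed

lemma sum_Pow_Un:
  assumes "finite A" "finite B" "A \<inter> B = {}"
  shows "(\<Sum>S\<in>Pow (A \<union> B). h S) = (\<Sum>U\<in>Pow A. \<Sum>V\<in>Pow B. h (U \<union> V))"
  using assms(1,3)
proof (induction A arbitrary: h rule: finite_induct)
  case (insert x A)
  have "(\<Sum>S\<in>Pow (insert x A \<union> B). h S) = (\<Sum>S\<in>Pow (A \<union> B). h S + h (insert x S))"
    using insert assms(2) sum_Pow_insert[of "A \<union> B" x h] by simp
  also have "\<dots> = (\<Sum>U\<in>Pow A. \<Sum>V\<in>Pow B. h (U \<union> V) + h (insert x (U \<union> V)))"
    using insert by (intro insert.IH) auto
  also have "\<dots> = (\<Sum>U\<in>Pow (insert x A). \<Sum>V\<in>Pow B. h (U \<union> V))"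
    by (subst sum_Pow_insert[OF insert.hyps]) (simp add: sum.distrib)
  finally show ?case .
qed simp

lemma wt_insert:
  assumes "finite A" "x \<notin> A" "U \<subseteq> A"
  shows "wt \<alpha> \<beta> (insert x A) U = \<beta> x * wt \<alpha> \<beta> A U"
    and "wt \<alpha> \<beta> (insert x A) (insert x U) = \<alpha> x * wt \<alpha> \<beta> A U"
proof -
  have "finite U" "x \<notin> U" using assms finite_subset by auto
  moreover have "insert x A - U = insert x (A - U)" "insert x A - insert x U = A - U"
    using assms by auto
  ultimately show "wt \<alpha> \<beta> (insert x A) U = \<beta> x * wt \<alpha> \<beta> A U"
    "wt \<alpha> \<beta> (insert x A) (insert x U) = \<alpha> x * wt \<alpha> \<beta> A U"
    using assms by (simp_all add: wt_def)
qed

lemma wt_Un: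
  assumes "finite A" "finite B" "A \<inter> B = {}" "U \<subseteq> A" "V \<subseteq> B"
  shows "wt \<alpha> \<beta> (A \<union> B) (U \<union> V) = wt \<alpha> \<beta> A U * wt \<alpha> \<beta> B V"
proof -
  have "A \<union> B - (U \<union> V) = (A - U) \<union> (B - V)" using assms by auto
  moreover have "(\<Prod>i\<in>(A - U) \<union> (B - V). \<beta> i) = (\<Prod>i\<in>A - U. \<beta> i) * (\<Prod>i\<in>B - V. \<beta> i)"
    using assms by (intro prod.union_disjoint) auto
  moreover have "(\<Prod>i\<in>U \<union> V. \<alpha> i) = (\<Prod>i\<in>U. \<alpha> i) * (\<Prod>i\<in>V. \<alpha> i)"
    using assms finite_subset by (intro prod.union_disjoint) auto
  ultimately show ?thesis by (simp add: wt_def)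
qed

lemma wt_nonneg:
  assumes "\<And>i. i \<in> A \<Longrightarrow> 0 \<le> \<alpha> i" "\<And>i. i \<in> A \<Longrightarrow> 0 \<le> \<beta> i" "U \<subseteq> A"
  shows "0 \<le> wt \<alpha> \<beta> A U"
  unfolding wt_def using assms by (intro mult_nonneg_nonneg prod_nonneg) auto

lemma level_insert:
  assumes "finite A" "x \<notin> A"
  shows "level \<alpha> \<beta> (insert x A) F k
    = \<beta> x * level \<alpha> \<beta> A F k + \<alpha> x * delay (level \<alpha> \<beta> A (\<lambda>U. F (insert x U))) k"
proof -
  have card: "card (insert x U) = Suc (card U)" if "U \<in> Pow A" for U
    using that assms finite_subset by (subst card_insert_disjoint) auto
  have "level \<alpha> \<beta> (insert x A) F k = (\<Sum>U\<in>Pow A. \<beta> x * (wt \<alpha> \<beta> A U * (F U * of_bool (card U = k)))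
      + \<alpha> x * (wt \<alpha> \<beta> A U * (F (insert x U) * of_bool (Suc (card U) = k))))"
    unfolding level_def sum_Pow_insert[OF assms]
    using assms card by (intro sum.cong refl) (auto simp: wt_insert)
  then show ?thesis
    by (cases k) (simp_all add: level_def sum.distrib sum_distrib_left)
qed

lemma sum_by_level:
  assumes "finite A"
  shows "(\<Sum>U\<in>Pow A. wt \<alpha> \<beta> A U * F U * h (card U)) = (\<Sum>k\<le>card A. level \<alpha> \<beta> A F k * h k)"
proof -
  have "(\<Sum>k\<le>card A. level \<alpha> \<beta> A F k * h k)
      = (\<Sum>U\<in>Pow A. \<Sum>k\<le>card A. wt \<alpha> \<beta> A U * (F U * of_bool (card U = k)) * h k)"
    unfolding level_def sum_distrib_right by (rule sum.swap)
  also have "\<dots> = (\<Sum>U\<in>Pow A. wt \<alpha> \<beta> A U * F U * h (card U))"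
  proof (intro sum.cong refl)
    fix U assume "U \<in> Pow A"
    then have "card U \<in> {..card A}" using assms by (simp add: card_mono)
    moreover have "(\<Sum>k\<le>card A. wt \<alpha> \<beta> A U * (F U * of_bool (card U = k)) * h k)
        = (\<Sum>k\<le>card A. if card U = k then wt \<alpha> \<beta> A U * F U * h k else 0)"
      by (intro sum.cong) auto
    ultimately show "(\<Sum>k\<le>card A. wt \<alpha> \<beta> A U * (F U * of_bool (card U = k)) * h k)
        = wt \<alpha> \<beta> A U * F U * h (card U)"
      by (simp add: sum.delta)
  qed
  finally show ?thesis by simp
qed

text \<open>Nonnegative weights with zero sum all vanish. This supplies the side conditions at zero
  denominators of the cross-multiplied inequalities.\<close>

lemma level_eq_0:
  assumes "finite A" "\<And>i. i \<in> A \<Longrightarrow> 0 \<le> \<alpha> i" "\<And>i. i \<in> A \<Longrightarrow> 0 \<le> \<beta> i"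
    and "level \<alpha> \<beta> A (\<lambda>_. 1) k = 0"
  shows "level \<alpha> \<beta> A F k = 0"
proof -
  have "\<forall>U\<in>Pow A. wt \<alpha> \<beta> A U * (1 * of_bool (card U = k)) = 0"
    using assms(4) unfolding level_def
    by (subst (asm) sum_nonneg_eq_0_iff) (use assms in \<open>auto intro!: wt_nonneg\<close>)
  then show ?thesis unfolding level_def by (intro sum.neutral) auto
qed

lemma level_mono:
  assumes "\<And>i. i \<in> A \<Longrightarrow> 0 \<le> \<alpha> i" "\<And>i. i \<in> A \<Longrightarrow> 0 \<le> \<beta> i"
    and "\<And>U. U \<subseteq> A \<Longrightarrow> F U \<le> G U"
  shows "level \<alpha> \<beta> A F k \<le> level \<alpha> \<beta> A G k"
  unfolding level_def using assms by (intro sum_mono mult_left_mono mult_right_mono wt_nonneg) auto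

lemma level_beyond_card:
  assumes "finite A" "card A < k"
  shows "level \<alpha> \<beta> A F k = 0"
  unfolding level_def
proof (intro sum.neutral ballI)
  fix U assume "U \<in> Pow A"
  then have "card U \<le> card A" using assms by (simp add: card_mono)
  then show "wt \<alpha> \<beta> A U * (F U * of_bool (card U = k)) = 0" using assms(2) by simp
qed

text \<open>A product of linear factors with nonnegative coefficients has log-concave coefficients:
  each factor is one convolution with a two-term sequence.\<close>

lemma strongly_lc_level:
  assumes "finite A" "\<And>i. i \<in> A \<Longrightarrow> 0 \<le> \<alpha> i" "\<And>i. i \<in> A \<Longrightarrow> 0 \<le> \<beta> i"
  shows "strongly_lc (level \<alpha> \<beta> A (\<lambda>_. 1))"
  using assms
proof (induction A rule: finite_induct)
  case empty
  show ?case by (auto simp: strongly_lc_def level_def wt_def)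
next
  case (insert x A)
  then show ?case
    unfolding level_insert[OF insert.hyps, abs_def] by (intro strongly_lc_delay) auto
qed

text \<open>The induction step of Efron's theorem: \<open>p\<close> holds the level weights of the
  old elements, \<open>X\<close> and \<open>Y\<close> the weighted sums of the function with the new
  element absent and present, and \<open>u\<close>, \<open>v\<close> are the weights of these two
  options. Log-concavity of \<open>p\<close> enters through the mixed terms.\<close>

lemma efron_step:
  fixes p X Y :: "nat \<Rightarrow> real"
  assumes p: "strongly_lc p"
    and X: "\<And>i j. i \<le> j \<Longrightarrow> X i * p j \<le> X j * p i"
    and Y: "\<And>i j. i \<le> j \<Longrightarrow> Y i * p j \<le> Y j * p i"
    and XY: "\<And>k. X k \<le> Y k" and zero: "\<And>k. p k = 0 \<Longrightarrow> X k = 0 \<and> Y k = 0"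
    and uv: "0 \<le> u" "0 \<le> v" and ij: "i \<le> j"
  shows "(u * X i + v * delay Y i) * (u * p j + v * delay p j)
       \<le> (u * X j + v * delay Y j) * (u * p i + v * delay p i)"
proof -
  have pnn: "0 \<le> p k" for k using p by (simp add: strongly_lc_def)
  have cross: "X i * delay p j + delay Y i * p j \<le> X j * delay p i + delay Y j * p i"
  proof (cases "i = j")
    case False
    then obtain j' where j: "j = Suc j'" "i \<le> j'" using ij by (cases j) auto
    have XYij: "X i * p j' \<le> Y j' * p i"
      using X[OF j(2)] mult_right_mono[OF XY[of j'] pnn[of i]] by linarith
    show ?thesis
    proof (cases i)
      case 0
      then show ?thesis using XYij j by simp
    next
      case (Suc i')
      have d: "delay p j = p j'" "delay Y j = Y j'" "delay p i = p i'" "delay Y i = Y i'"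
        using j Suc by simp_all
      have lc: "p i' * p j \<le> p i * p j'"
        using p j Suc by (auto simp: strongly_lc_def)
      show ?thesis
      proof (cases "p i' = 0 \<or> p j = 0")
        \<comment> \<open>Zeros of \<open>p\<close> annihilate the terms with \<open>Y i'\<close>
          and \<open>X j\<close>, leaving \<open>XYij\<close>.\<close>
        case True
        then have "Y i' * p j = 0" "X j * p i' = 0" using zero by auto
        then show ?thesis using XYij unfolding d by linarith
      next
        case False
        then have pos': "0 < p i'" "0 < p j" using pnn less_le by (metis)+
        then have "0 < p i * p j'" using lc mult_pos_pos[OF pos'] by linarith
        then have pos: "0 < p i" "0 < p j'" using pnn[of i] pnn[of j'] by (auto simp: zero_less_mult_iff)
        \<comment> \<open>In terms of these averages the claim reads (y i' - x j) p i' p j \<le> (y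
          j' - x i) p i p j'. Monotonicity compares the brackets and makes the right one
          nonnegative; log-concavity compares the products.\<close>
        define x y where "x k = X k / p k" and "y k = Y k / p k" for k
        have e: "X i = x i * p i" "X j = x j * p j" "Y i' = y i' * p i'" "Y j' = y j' * p j'"
          using pos pos' by (auto simp: x_def y_def)
        have xx: "x i \<le> x j" "x i \<le> y j'" "y i' \<le> y j'"
          using pos pos' X[OF ij] XYij Y[of i' j'] j Suc
          by (auto simp: x_def y_def divide_simps mult.commute)
        have "(y i' - x j) * (p i' * p j) \<le> (y j' - x i) * (p i' * p j)"
          using xx pos' by (intro mult_right_mono) auto
        also have "\<dots> \<le> (y j' - x i) * (p i * p j')"
          using xx lc by (intro mult_left_mono) auto
        finally show ?thesis using j Suc by (simp add: e[simplified j Suc] algebra_simps)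
      qed
    qed
  qed simp
  have diag: "delay Y i * delay p j \<le> delay Y j * delay p i"
    using ij Y[of "i - 1" "j - 1"] by (cases i; cases j) auto
  have "u^2 * (X i * p j) \<le> u^2 * (X j * p i)"
    using X[OF ij] by (intro mult_left_mono) auto
  moreover have "v^2 * (delay Y i * delay p j) \<le> v^2 * (delay Y j * delay p i)"
    using diag by (intro mult_left_mono) auto
  moreover have "(u * v) * (X i * delay p j + delay Y i * p j) \<le> (u * v) * (X j * delay p i + delay Y j * p i)"
    using cross uv by (intro mult_left_mono) auto
  ultimately have "u^2 * (X i * p j) + v^2 * (delay Y i * delay p j) + (u * v) * (X i * delay p j + delay Y i * p j)
     \<le> u^2 * (X j * p i) + v^2 * (delay Y j * delay p i) + (u * v) * (X j * delay p i + delay Y j * p i)"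
    by linarith
  then show ?thesis by (simp add: algebra_simps power2_eq_square)
qed

text \<open>
  \<open>level \<alpha> \<beta> A F k / level \<alpha> \<beta> A (\<lambda>_. 1) k\<close> is the expectation of \<open>F\<close>
  given that \<open>k\<close> elements of \<open>A\<close> are present.
\<close>

lemma efron:
  assumes "finite A" "\<And>i. i \<in> A \<Longrightarrow> 0 \<le> \<alpha> i" "\<And>i. i \<in> A \<Longrightarrow> 0 \<le> \<beta> i"
    and "mono_on (Pow A) F" "k \<le> l"
  shows "level \<alpha> \<beta> A F k * level \<alpha> \<beta> A (\<lambda>_. 1) l \<le> level \<alpha> \<beta> A F l * level \<alpha> \<beta> A (\<lambda>_. 1) k"
  using assms
proof (induction A arbitrary: F k l rule: finite_induct)
  case empty
  then show ?case by (auto simp: level_def wt_def)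
next
  case (insert x A)
  have m: "mono_on (Pow A) F" "mono_on (Pow A) (\<lambda>U. F (insert x U))"
    by (intro mono_onI; rule mono_onD[OF insert.prems(3)]; auto)+
  have le: "F U \<le> F (insert x U)" if "U \<subseteq> A" for U
    using that by (intro mono_onD[OF insert.prems(3)]) auto
  have nn: "\<And>i. i \<in> A \<Longrightarrow> 0 \<le> \<alpha> i" "\<And>i. i \<in> A \<Longrightarrow> 0 \<le> \<beta> i" "0 \<le> \<beta> x" "0 \<le> \<alpha> x"
    using insert.prems by auto
  show ?case
    unfolding level_insert[OF insert.hyps]
    by (rule efron_step[OF strongly_lc_level[OF insert.hyps(1) nn(1,2)]
          insert.IH[OF nn(1,2) m(1)] insert.IH[OF nn(1,2) m(2)] level_mono[OF nn(1,2) le]])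
      (use insert nn in \<open>auto intro: level_eq_0\<close>)
qed

section \<open>Negative correlation across two disjoint blocks\<close>

text \<open>\<open>F0\<close> and \<open>F1\<close> are the slices of one increasing function at
  absent and present special element. Grouping by sizes leaves sums over \<open>l\<close>, in which
  the average of \<open>G\<close> increases by Efron's theorem and that of the slices decreases;
  Chebyshev's inequality concludes.\<close>

lemma negative_correlation_sum:
  fixes a b :: "nat \<Rightarrow> real"
  defines "T \<equiv> \<lambda>A B \<alpha> \<beta> \<phi> \<psi>. \<Sum>U\<in>Pow A. \<Sum>V\<in>Pow B. wt \<alpha> \<beta> A U * wt \<alpha> \<beta> B V *
      (a (card U + card V) * \<phi> U V + b (card U + card V) * \<psi> U V)"
  assumes fin: "finite A" "finite B"
    and nn: "\<And>i. i \<in> A \<union> B \<Longrightarrow> 0 \<le> \<alpha> i" "\<And>i. i \<in> A \<union> B \<Longrightarrow> 0 \<le> \<beta> i"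
    and ab: "compatible a b"
    and F0: "mono_on (Pow A) F0" and F1: "mono_on (Pow A) F1"
    and F01: "\<And>U. U \<subseteq> A \<Longrightarrow> F0 U \<le> F1 U"
    and G: "mono_on (Pow B) G"
  shows "T A B \<alpha> \<beta> (\<lambda>U V. F0 U * G V) (\<lambda>U V. F1 U * G V) * T A B \<alpha> \<beta> (\<lambda>U V. 1) (\<lambda>U V. 1)
      \<le> T A B \<alpha> \<beta> (\<lambda>U V. F0 U) (\<lambda>U V. F1 U) * T A B \<alpha> \<beta> (\<lambda>U V. G V) (\<lambda>U V. G V)"
proof -
  have nnA: "\<And>i. i \<in> A \<Longrightarrow> 0 \<le> \<alpha> i" "\<And>i. i \<in> A \<Longrightarrow> 0 \<le> \<beta> i"
    and nnB: "\<And>i. i \<in> B \<Longrightarrow> 0 \<le> \<alpha> i" "\<And>i. i \<in> B \<Longrightarrow> 0 \<le> \<beta> i"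
    using nn by auto
  let ?LA = "level \<alpha> \<beta> A" and ?LB = "level \<alpha> \<beta> B"
  \<comment> \<open>The sum over \<open>A\<close> and over the state of the special element, with
    \<open>l\<close> elements of \<open>B\<close> fixed.\<close>
  define R where "R f g l = (\<Sum>k\<le>card A. ?LA f k * a (k + l) + ?LA g k * b (k + l))" for f g l
  have T: "T A B \<alpha> \<beta> (\<lambda>U V. f U * h V) (\<lambda>U V. g U * h V) = (\<Sum>l\<le>card B. R f g l * ?LB h l)" for f g h
  proof -
    have R: "R f g l = (\<Sum>U\<in>Pow A. wt \<alpha> \<beta> A U * (a (card U + l) * f U + b (card U + l) * g U))" for l
      unfolding R_def sum.distrib sum_by_level[OF fin(1), symmetric]
      by (simp add: sum.distrib[symmetric] algebra_simps)
    have "(\<Sum>l\<le>card B. R f g l * ?LB h l) = (\<Sum>V\<in>Pow B. wt \<alpha> \<beta> B V * h V * R f g (card V))"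
      unfolding sum_by_level[OF fin(2)] by (simp add: mult.commute)
    also have "\<dots> = T A B \<alpha> \<beta> (\<lambda>U V. f U * h V) (\<lambda>U V. g U * h V)"
      unfolding T_def R sum_distrib_left by (subst sum.swap) (simp add: algebra_simps)
    finally show ?thesis by simp
  qed
  have "(\<Sum>l\<le>card B. R F0 F1 l * ?LB G l) * (\<Sum>l\<le>card B. R (\<lambda>_. 1) (\<lambda>_. 1) l * ?LB (\<lambda>_. 1) l)
      \<le> (\<Sum>l\<le>card B. R F0 F1 l * ?LB (\<lambda>_. 1) l) * (\<Sum>l\<le>card B. R (\<lambda>_. 1) (\<lambda>_. 1) l * ?LB G l)"
  proof (rule chebyshev_sum)
    fix i j :: nat assume ij: "i \<le> j"
    show "?LB G i * ?LB (\<lambda>_. 1) j \<le> ?LB (\<lambda>_. 1) i * ?LB G j"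
      using efron[OF fin(2) nnB G ij] by (simp add: mult.commute)
    have "R F0 F1 j * (\<Sum>k\<le>card A. ?LA (\<lambda>_. 1) k * (a (k + i) + b (k + i)))
       \<le> R F0 F1 i * (\<Sum>k\<le>card A. ?LA (\<lambda>_. 1) k * (a (k + j) + b (k + j)))"
      unfolding R_def
      by (rule conditional_expectation_antimono[OF ab strongly_lc_level[OF fin(1) nnA] ij
            level_beyond_card[OF fin(1)] efron[OF fin(1) nnA F0] efron[OF fin(1) nnA F1] level_mono[OF nnA F01]])
        (use level_eq_0[OF fin(1) nnA] in auto)
    then show "R F0 F1 j * R (\<lambda>_. 1) (\<lambda>_. 1) i \<le> R F0 F1 i * R (\<lambda>_. 1) (\<lambda>_. 1) j"
      by (simp add: R_def distrib_left)
  qed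
  then show ?thesis
    using T[of F0 G F1] T[of "\<lambda>_. 1" "\<lambda>_. 1" "\<lambda>_. 1"] T[of F0 "\<lambda>_. 1" F1] T[of "\<lambda>_. 1" G "\<lambda>_. 1"] by simp
qed

subsection \<open>Almost exchangeable measures\<close>

text \<open>
  The special element \<open>s\<close> need not lie in \<open>E\<close>: it may have been projected out, and then \<open>b\<close> is
  irrelevant.
\<close>

definition almost_exchangeable :: "'a set \<Rightarrow> 'a set pmf \<Rightarrow> bool" where
  "almost_exchangeable E \<mu> \<longleftrightarrow> finite E \<and> measure_on E \<mu> \<and>
     (\<exists>s \<alpha> \<beta> a b. (\<forall>i\<in>E. 0 \<le> \<alpha> i \<and> 0 \<le> \<beta> i) \<and> compatible a b \<and>
        (\<forall>S\<subseteq>E. pmf \<mu> S = (if s \<in> S then b else a) (card (S - {s})) * wt \<alpha> \<beta> (E - {s}) (S - {s})))"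

lemma expectation_eq_sum:
  assumes "finite E" "measure_on E \<mu>"
  shows "measure_pmf.expectation \<mu> F = (\<Sum>S\<in>Pow E. pmf \<mu> S * F S)"
  using assms by (subst integral_measure_pmf_real[where A = "Pow E"])
    (auto simp: measure_on_def mult.commute)

text \<open>The case in which \<open>s\<close> is not among the coordinates of \<open>G\<close>.
  Splitting by the presence of \<open>s\<close> turns each expectation into a double sum over the
  two blocks.\<close>

lemma almost_exchangeable_negative_correlation:
  fixes F G :: "'a set \<Rightarrow> real"
  assumes E: "finite E" "measure_on E \<mu>"
    and nn: "\<And>i. i \<in> E \<Longrightarrow> 0 \<le> \<alpha> i" "\<And>i. i \<in> E \<Longrightarrow> 0 \<le> \<beta> i"
    and ab: "compatible a b"
    and pmf: "\<And>S. S \<subseteq> E \<Longrightarrow>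
        pmf \<mu> S = (if s \<in> S then b else a) (card (S - {s})) * wt \<alpha> \<beta> (E - {s}) (S - {s})"
    and F: "mono_on (Pow E) F" "depends_on E F A" and G: "mono_on (Pow E) G" "depends_on E G B"
    and B: "B \<subseteq> E" "A \<inter> B = {}" "s \<notin> B"
  shows "measure_pmf.expectation \<mu> (\<lambda>S. F S * G S)
      \<le> measure_pmf.expectation \<mu> F * measure_pmf.expectation \<mu> G"
proof -
  \<comment> \<open>Every ordinary coordinate outside \<open>B\<close>, whether in \<open>A\<close>
    or not, goes to the side of \<open>F\<close>.\<close>
  define A' where "A' = E - B - {s}"
  \<comment> \<open>If \<open>s \<notin> E\<close>, no subset of \<open>E\<close> contains
    \<open>s\<close>, so the second slice must carry no mass.\<close>
  define b' where "b' = (if s \<in> E then b else (\<lambda>_. 0))"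
  define T where "T = (\<lambda>\<phi> \<psi>. \<Sum>U\<in>Pow A'. \<Sum>V\<in>Pow B. wt \<alpha> \<beta> A' U * wt \<alpha> \<beta> B V *
      (a (card U + card V) * \<phi> U V + b' (card U + card V) * \<psi> U V))"
  have fin: "finite A'" "finite B" using E B finite_subset by (auto simp: A'_def)
  have dis: "A' \<inter> B = {}" "s \<notin> A'" "E - {s} = A' \<union> B" using B by (auto simp: A'_def)
  have ab': "compatible a b'"
    using ab compatible_scale[OF ab, of 1 0] by (auto simp: b'_def)
  have card: "card (U \<union> V) = card U + card V" if "U \<subseteq> A'" "V \<subseteq> B" for U V
    using that fin dis finite_subset by (intro card_Un_disjoint) auto
  have pmf0: "pmf \<mu> (U \<union> V) = wt \<alpha> \<beta> A' U * wt \<alpha> \<beta> B V * a (card U + card V)"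
    if "U \<subseteq> A'" "V \<subseteq> B" for U V
  proof -
    have "U \<union> V \<subseteq> E" "s \<notin> U \<union> V" "U \<union> V - {s} = U \<union> V" using that dis B by (auto simp: A'_def)
    then show ?thesis using pmf[of "U \<union> V"] that card[OF that] wt_Un[OF fin dis(1) that] dis(3) by simp
  qed
  have pmf1: "pmf \<mu> (insert s (U \<union> V)) = wt \<alpha> \<beta> A' U * wt \<alpha> \<beta> B V * b (card U + card V)"
    if "U \<subseteq> A'" "V \<subseteq> B" "s \<in> E" for U V
  proof -
    have "insert s (U \<union> V) \<subseteq> E" "insert s (U \<union> V) - {s} = U \<union> V"
      using that dis B by (auto simp: A'_def)
    then show ?thesis
      using pmf[of "insert s (U \<union> V)"] that card[OF that(1,2)] wt_Un[OF fin dis(1) that(1,2)] dis(3) by simp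
  qed
  have T: "measure_pmf.expectation \<mu> H = T \<phi> \<psi>"
    if H: "\<And>U V. U \<subseteq> A' \<Longrightarrow> V \<subseteq> B \<Longrightarrow> H (U \<union> V) = \<phi> U V"
      "\<And>U V. U \<subseteq> A' \<Longrightarrow> V \<subseteq> B \<Longrightarrow> s \<in> E \<Longrightarrow> H (insert s (U \<union> V)) = \<psi> U V" for H \<phi> \<psi>
  proof (cases "s \<in> E")
    case True
    then have Eq: "E = insert s (A' \<union> B)" using dis(3) by auto
    have "measure_pmf.expectation \<mu> H = (\<Sum>S\<in>Pow (insert s (A' \<union> B)). pmf \<mu> S * H S)"
      using expectation_eq_sum[OF E, of H] Eq by simp
    also have "\<dots> = (\<Sum>S\<in>Pow (A' \<union> B). pmf \<mu> S * H S + pmf \<mu> (insert s S) * H (insert s S))"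
      using fin dis B by (intro sum_Pow_insert) auto
    also have "\<dots> = (\<Sum>U\<in>Pow A'. \<Sum>V\<in>Pow B. pmf \<mu> (U \<union> V) * H (U \<union> V) +
        pmf \<mu> (insert s (U \<union> V)) * H (insert s (U \<union> V)))"
      by (rule sum_Pow_Un[OF fin dis(1)])
    also have "\<dots> = T \<phi> \<psi>"
      unfolding T_def using True
      by (intro sum.cong refl) (simp add: pmf0 pmf1 H b'_def algebra_simps)
    finally show ?thesis .
  next
    case False
    then have Eq: "E = A' \<union> B" using dis(3) by auto
    have "measure_pmf.expectation \<mu> H = (\<Sum>S\<in>Pow (A' \<union> B). pmf \<mu> S * H S)"
      using expectation_eq_sum[OF E, of H] Eq by simp
    also have "\<dots> = (\<Sum>U\<in>Pow A'. \<Sum>V\<in>Pow B. pmf \<mu> (U \<union> V) * H (U \<union> V))"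
      by (rule sum_Pow_Un[OF fin dis(1)])
    also have "\<dots> = T \<phi> \<psi>"
      unfolding T_def using False
      by (intro sum.cong refl) (simp add: pmf0 H b'_def algebra_simps)
    finally show ?thesis .
  qed
  have FU: "F (U \<union> V) = F U" if "U \<subseteq> A'" "V \<subseteq> B" for U V
  proof -
    have "U \<union> V \<subseteq> E" "U \<subseteq> E" "(U \<union> V) \<inter> A = U \<inter> A" using that B by (auto simp: A'_def)
    then show ?thesis using F(2) unfolding depends_on_def by blast
  qed
  have FsU: "F (insert s (U \<union> V)) = F (insert s U)" if "U \<subseteq> A'" "V \<subseteq> B" "s \<in> E" for U V
  proof -
    have "insert s (U \<union> V) \<subseteq> E" "insert s U \<subseteq> E" "insert s (U \<union> V) \<inter> A = insert s U \<inter> A"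
      using that B by (auto simp: A'_def)
    then show ?thesis using F(2) unfolding depends_on_def by blast
  qed
  have GV: "G (U \<union> V) = G V" if "U \<subseteq> A'" "V \<subseteq> B" for U V
  proof -
    have "U \<union> V \<subseteq> E" "V \<subseteq> E" "(U \<union> V) \<inter> B = V \<inter> B" using that B by (auto simp: A'_def)
    then show ?thesis using G(2) unfolding depends_on_def by blast
  qed
  have GsV: "G (insert s (U \<union> V)) = G V" if "U \<subseteq> A'" "V \<subseteq> B" "s \<in> E" for U V
  proof -
    have "insert s (U \<union> V) \<subseteq> E" "V \<subseteq> E" "insert s (U \<union> V) \<inter> B = V \<inter> B"
      using that B by (auto simp: A'_def)
    then show ?thesis using G(2) unfolding depends_on_def by blast
  qed
  \<comment> \<open>For \<open>s \<notin> E\<close> these values have weight zero in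
    \<open>T\<close>; \<open>F U\<close> keeps \<open>F1\<close> increasing and above
    \<open>F\<close>.\<close>
  define F1 where "F1 U = (if s \<in> E then F (insert s U) else F U)" for U
  have "T (\<lambda>U V. F U * G V) (\<lambda>U V. F1 U * G V) * T (\<lambda>U V. 1) (\<lambda>U V. 1)
      \<le> T (\<lambda>U V. F U) (\<lambda>U V. F1 U) * T (\<lambda>U V. G V) (\<lambda>U V. G V)"
    unfolding T_def
  proof (rule negative_correlation_sum[OF fin _ _ ab'])
    show "0 \<le> \<alpha> i" "0 \<le> \<beta> i" if "i \<in> A' \<union> B" for i
      using that nn B by (auto simp: A'_def)
    show "mono_on (Pow A') F" "mono_on (Pow B) G"
      by (intro mono_onI; (rule mono_onD[OF F(1)] | rule mono_onD[OF G(1)]); use B in \<open>auto simp: A'_def\<close>)+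
    show "mono_on (Pow A') F1"
      unfolding F1_def by (intro mono_onI) (auto intro!: mono_onD[OF F(1)] simp: A'_def)
    show "F U \<le> F1 U" if "U \<subseteq> A'" for U
      using that unfolding F1_def by (auto intro!: mono_onD[OF F(1)] simp: A'_def)
  qed
  moreover have "measure_pmf.expectation \<mu> (\<lambda>S. F S * G S) = T (\<lambda>U V. F U * G V) (\<lambda>U V. F1 U * G V)"
    by (intro T) (auto simp: FU FsU GV GsV F1_def)
  moreover have "measure_pmf.expectation \<mu> (\<lambda>S. 1) = T (\<lambda>U V. 1) (\<lambda>U V. 1)"
    by (intro T) auto
  moreover have "measure_pmf.expectation \<mu> F = T (\<lambda>U V. F U) (\<lambda>U V. F1 U)"
    by (intro T) (auto simp: FU FsU F1_def)
  moreover have "measure_pmf.expectation \<mu> G = T (\<lambda>U V. G V) (\<lambda>U V. G V)"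
    by (intro T) (auto simp: GV GsV)
  ultimately show ?thesis by simp
qed

lemma almost_exchangeable_NA:
  assumes "almost_exchangeable E \<mu>"
  shows "NA E \<mu>"
proof -
  obtain s \<alpha> \<beta> a b where E: "finite E" "measure_on E \<mu>"
    and nn': "\<forall>i\<in>E. 0 \<le> \<alpha> i \<and> 0 \<le> \<beta> i" and ab: "compatible a b"
    and pmf': "\<forall>S\<subseteq>E.
        pmf \<mu> S = (if s \<in> S then b else a) (card (S - {s})) * wt \<alpha> \<beta> (E - {s}) (S - {s})"
    using assms unfolding almost_exchangeable_def by (elim conjE exE) (rule that)
  note nn = nn'[rule_format, THEN conjunct1] nn'[rule_format, THEN conjunct2] and pmf = pmf'[rule_format]
  note cov = almost_exchangeable_negative_correlation[OF E nn ab pmf]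
  show ?thesis
    unfolding NA_def
  proof (intro allI impI, elim conjE)
    fix F G :: "'a set \<Rightarrow> real" and A B
    assume *: "mono_on (Pow E) F" "mono_on (Pow E) G" "A \<subseteq> E" "B \<subseteq> E" "A \<inter> B = {}"
      "depends_on E F A" "depends_on E G B"
    show "measure_pmf.expectation \<mu> (\<lambda>S. F S * G S)
      \<le> measure_pmf.expectation \<mu> F * measure_pmf.expectation \<mu> G"
    proof (cases "s \<in> B")
      case False
      then show ?thesis using * by (intro cov[of F A G B]) auto
    next
      \<comment> \<open>The inequality is symmetric in \<open>F\<close> and \<open>G\<close>, and
        \<open>A\<close>, being disjoint from \<open>B\<close>, does not contain
        \<open>s\<close>.\<close>
      case True
      then have "measure_pmf.expectation \<mu> (\<lambda>S. G S * F S)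
        \<le> measure_pmf.expectation \<mu> G * measure_pmf.expectation \<mu> F"
        using * by (intro cov[of G B F A]) auto
      then show ?thesis by (simp add: mult.commute)
    qed
  qed
qed

section \<open>Closure under external fields, conditioning and projection\<close>

text \<open>Polynomials are given as functions, so their coefficients have to be recovered. With one
  variable frozen at \<open>t\<close>, induction equates expressions affine in \<open>t\<close>; the
  values 0 and 1 separate their coefficients.\<close>

lemma multiaffine_coeff_unique:
  fixes c d :: "'a set \<Rightarrow> real"
  assumes "finite E" "\<And>z. (\<Sum>S\<in>Pow E. c S * (\<Prod>i\<in>S. z i)) = (\<Sum>S\<in>Pow E. d S * (\<Prod>i\<in>S. z i))"
    and "S \<subseteq> E"
  shows "c S = d S"
  using assms
proof (induction E arbitrary: c d S rule: finite_induct)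
  case (insert x E)
  have split: "(\<Sum>S\<in>Pow (insert x E). c S * (\<Prod>i\<in>S. (z(x := t)) i))
      = (\<Sum>S\<in>Pow E. (c S + t * c (insert x S)) * (\<Prod>i\<in>S. z i))" for c :: "'a set \<Rightarrow> real" and z t
    unfolding sum_Pow_insert[OF insert.hyps]
  proof (intro sum.cong refl)
    fix S assume "S \<in> Pow E"
    then have "finite S" "x \<notin> S" using insert.hyps finite_subset by auto
    moreover from \<open>x \<notin> S\<close> have "(\<Prod>i\<in>S. (z(x := t)) i) = (\<Prod>i\<in>S. z i)" by (intro prod.cong) auto
    ultimately show "c S * (\<Prod>i\<in>S. (z(x := t)) i) + c (insert x S) * (\<Prod>i\<in>insert x S. (z(x := t)) i)
        = (c S + t * c (insert x S)) * (\<Prod>i\<in>S. z i)"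
      by (simp add: algebra_simps)
  qed
  have eq: "c S + t * c (insert x S) = d S + t * d (insert x S)" if "S \<subseteq> E" for S t
  proof (rule insert.IH[OF _ that])
    fix z show "(\<Sum>S\<in>Pow E. (c S + t * c (insert x S)) * (\<Prod>i\<in>S. z i))
        = (\<Sum>S\<in>Pow E. (d S + t * d (insert x S)) * (\<Prod>i\<in>S. z i))"
      using insert.prems(1)[of "z(x := t)"] unfolding split .
  qed
  show ?case
  proof (cases "x \<in> S")
    case False
    then show ?thesis using eq[of S 0] insert.prems(2) by (simp add: subset_insert)
  next
    case True
    then have "S - {x} \<subseteq> E" "insert x (S - {x}) = S" using insert.prems(2) by auto
    then show ?thesis using eq[of "S - {x}" 0] eq[of "S - {x}" 1] by simp
  qed
qed simp

lemma pmf_external_field: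
  assumes "finite E" "is_external_field E f \<mu> \<nu>" "S \<subseteq> E"
  shows "pmf \<nu> S = pmf \<mu> S * (\<Prod>i\<in>S. f i) / gen_poly E \<mu> f"
proof (rule multiaffine_coeff_unique[OF assms(1) _ assms(3)])
  fix z
  have "(\<Sum>S\<in>Pow E. pmf \<nu> S * (\<Prod>i\<in>S. z i)) = gen_poly E \<mu> (\<lambda>i. f i * z i) / gen_poly E \<mu> f"
    using assms(2) by (simp add: is_external_field_def gen_poly_def)
  also have "\<dots> = (\<Sum>S\<in>Pow E. (pmf \<mu> S * (\<Prod>i\<in>S. f i) / gen_poly E \<mu> f) * (\<Prod>i\<in>S. z i))"
    by (simp add: gen_poly_def[of E \<mu> "\<lambda>i. f i * z i"] prod.distrib sum_divide_distrib mult.assoc)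
  finally show "(\<Sum>S\<in>Pow E. pmf \<nu> S * (\<Prod>i\<in>S. z i))
      = (\<Sum>S\<in>Pow E. (pmf \<mu> S * (\<Prod>i\<in>S. f i) / gen_poly E \<mu> f) * (\<Prod>i\<in>S. z i))" .
qed

text \<open>Field factors of ordinary elements are absorbed into \<open>\<alpha>\<close>, that of
  \<open>s\<close> into \<open>b\<close>, and the normalisation into both sequences.\<close>

lemma almost_exchangeable_external_field:
  assumes "almost_exchangeable E \<mu>" "is_external_field E f \<mu> \<nu>"
  shows "almost_exchangeable E \<nu>"
proof -
  obtain s \<alpha> \<beta> a b where E: "finite E" and "measure_on E \<mu>"
    and nn': "\<forall>i\<in>E. 0 \<le> \<alpha> i \<and> 0 \<le> \<beta> i" and ab: "compatible a b"
    and pmf': "\<forall>S\<subseteq>E.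
        pmf \<mu> S = (if s \<in> S then b else a) (card (S - {s})) * wt \<alpha> \<beta> (E - {s}) (S - {s})"
    using assms(1) unfolding almost_exchangeable_def by (elim conjE exE) (rule that)
  note nn = nn'[rule_format, THEN conjunct1] nn'[rule_format, THEN conjunct2] and pmf = pmf'[rule_format]
  have f: "\<And>i. i \<in> E \<Longrightarrow> 0 \<le> f i" and on: "measure_on E \<nu>"
    using assms(2) by (auto simp: is_external_field_def)
  define g where "g = gen_poly E \<mu> f"
  have g: "0 \<le> g"
    unfolding g_def gen_poly_def using f
    by (intro sum_nonneg mult_nonneg_nonneg prod_nonneg) auto
  \<comment> \<open>The field is unconstrained off \<open>E\<close>; the value 0 keeps the scaling
    factor nonnegative when \<open>s \<notin> E\<close>.\<close>
  define t where "t = (if s \<in> E then f s else 0)"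
  have ab': "compatible (\<lambda>k. (1 / g) * a k) (\<lambda>k. (t / g) * b k)"
    using f g by (intro compatible_scale[OF ab]) (auto simp: t_def)
  have eq: "pmf \<nu> S = (if s \<in> S then (\<lambda>k. (t / g) * b k) else (\<lambda>k. (1 / g) * a k)) (card (S - {s}))
      * wt (\<lambda>i. \<alpha> i * f i) \<beta> (E - {s}) (S - {s})" if "S \<subseteq> E" for S
  proof -
    have "finite S" using that E finite_subset by blast
    then have f_split: "(\<Prod>i\<in>S. f i) = (if s \<in> S then t else 1) * (\<Prod>i\<in>S - {s}. f i)"
      using that by (auto simp: t_def prod.remove)
    have wt_split: "wt (\<lambda>i. \<alpha> i * f i) \<beta> (E - {s}) (S - {s})
        = wt \<alpha> \<beta> (E - {s}) (S - {s}) * (\<Prod>i\<in>S - {s}. f i)"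
      unfolding wt_def prod.distrib by (simp only: ac_simps)
    show ?thesis
      unfolding pmf_external_field[OF E assms(2) that] pmf[OF that] f_split wt_split g_def[symmetric]
      by (cases "s \<in> S")
        (simp_all only: if_True if_False times_divide_eq_left times_divide_eq_right ac_simps mult_1_left)
  qed
  show ?thesis
    unfolding almost_exchangeable_def
    using E on nn f ab' eq
    by (intro conjI exI[of _ s] exI[of _ "\<lambda>i. \<alpha> i * f i"] exI[of _ \<beta>]
        exI[of _ "\<lambda>k. (1 / g) * a k"] exI[of _ "\<lambda>k. (t / g) * b k"]) auto
qed

text \<open>A forbidden value is encoded by a zero factor: in \<open>\<alpha>\<close> or
  \<open>\<beta>\<close> for an ordinary element, in front of \<open>a\<close> or \<open>b\<close>
  for \<open>s\<close>. The remaining weights are divided by the probability of the event.\<close>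

lemma almost_exchangeable_cond:
  assumes "almost_exchangeable E \<mu>" "C \<subseteq> E"
    and pos: "0 < measure_pmf.prob \<mu> (cond_event C v)"
  shows "almost_exchangeable E (cond_pmf \<mu> (cond_event C v))"
proof -
  obtain s \<alpha> \<beta> a b where E: "finite E" and on: "measure_on E \<mu>"
    and nn': "\<forall>i\<in>E. 0 \<le> \<alpha> i \<and> 0 \<le> \<beta> i" and ab: "compatible a b"
    and pmf': "\<forall>S\<subseteq>E.
        pmf \<mu> S = (if s \<in> S then b else a) (card (S - {s})) * wt \<alpha> \<beta> (E - {s}) (S - {s})"
    using assms(1) unfolding almost_exchangeable_def by (elim conjE exE) (rule that)
  note nn = nn'[rule_format, THEN conjunct1] nn'[rule_format, THEN conjunct2] and pmf = pmf'[rule_format]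
  let ?Q = "cond_event C v"
  define q where "q = measure_pmf.prob \<mu> ?Q"
  have ne: "set_pmf \<mu> \<inter> ?Q \<noteq> {}"
    using pos by (metis measure_pmf_zero_iff less_irrefl)
  define ua ub :: real where "ua = (if s \<in> C \<and> v s then 0 else 1 / q)"
    and "ub = (if s \<in> C \<and> \<not> v s then 0 else 1 / q)"
  define \<alpha>' \<beta>' where "\<alpha>' i = (if i \<in> C \<and> \<not> v i then 0 else \<alpha> i)"
    and "\<beta>' i = (if i \<in> C \<and> v i then 0 else \<beta> i)" for i
  have ab': "compatible (\<lambda>k. ua * a k) (\<lambda>k. ub * b k)"
    using pos by (intro compatible_scale[OF ab]) (auto simp: ua_def ub_def q_def)
  have eq: "pmf (cond_pmf \<mu> ?Q) S = (if s \<in> S then (\<lambda>k. ub * b k) else (\<lambda>k. ua * a k)) (card (S - {s}))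
      * wt \<alpha>' \<beta>' (E - {s}) (S - {s})" if S: "S \<subseteq> E" for S
  proof (cases "S \<in> ?Q")
    case True
    then have v: "i \<in> S \<longleftrightarrow> v i" if "i \<in> C" for i using that by (auto simp: cond_event_def)
    have "wt \<alpha>' \<beta>' (E - {s}) (S - {s}) = wt \<alpha> \<beta> (E - {s}) (S - {s})"
      unfolding wt_def by (intro arg_cong2[where f = "(*)"] prod.cong) (auto simp: \<alpha>'_def \<beta>'_def v)
    moreover have "s \<in> S \<Longrightarrow> ub = 1 / q" "s \<notin> S \<Longrightarrow> ua = 1 / q" by (auto simp: ub_def ua_def v)
    ultimately show ?thesis using True pmf[OF S] by (simp add: pmf_cond[OF ne] q_def)
  next
    case False
    then obtain i where i: "i \<in> C" "(i \<in> S) \<noteq> v i" by (auto simp: cond_event_def)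
    have fin: "finite (S - {s})" "finite (E - {s} - (S - {s}))" using E S finite_subset by auto
    have "(if s \<in> S then ub else ua) * wt \<alpha>' \<beta>' (E - {s}) (S - {s}) = 0"
    proof (cases "i = s")
      case True
      then show ?thesis using i by (auto simp: ub_def ua_def)
    next
      case False
      show ?thesis
      proof (cases "i \<in> S")
        case True
        then have "i \<in> S - {s}" "\<alpha>' i = 0" using False i by (auto simp: \<alpha>'_def)
        then have "(\<Prod>i\<in>S - {s}. \<alpha>' i) = 0" using fin by (intro prod_zero) auto
        then show ?thesis by (simp add: wt_def)
      next
        case notin: False
        then have "i \<in> E - {s} - (S - {s})" "\<beta>' i = 0" using False i assms(2) by (auto simp: \<beta>'_def)
        then have "(\<Prod>i\<in>E - {s} - (S - {s}). \<beta>' i) = 0" using fin by (intro prod_zero) auto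
        then show ?thesis by (simp add: wt_def)
      qed
    qed
    then show ?thesis using False by (auto simp: pmf_cond[OF ne])
  qed
  have "measure_on E (cond_pmf \<mu> ?Q)" using on by (auto simp: measure_on_def set_cond_pmf[OF ne])
  then show ?thesis
    unfolding almost_exchangeable_def
    using E nn ab' eq
    by (intro conjI exI[of _ s] exI[of _ \<alpha>'] exI[of _ \<beta>']
        exI[of _ "\<lambda>k. ua * a k"] exI[of _ "\<lambda>k. ub * b k"]) (auto simp: \<alpha>'_def \<beta>'_def)
qed

text \<open>Each \<open>T\<close> receives the mass of \<open>T\<close> and of
  \<open>insert x T\<close>. Removing \<open>s\<close> adds the slices; removing an ordinary element
  mixes each sequence with its shift, since its presence raises the count by one.\<close>

lemma almost_exchangeable_remove:
  assumes "almost_exchangeable E \<mu>" "x \<in> E"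
  shows "almost_exchangeable (E - {x}) (map_pmf (\<lambda>T. T \<inter> (E - {x})) \<mu>)"
proof -
  obtain s \<alpha> \<beta> a b where E: "finite E" and on: "measure_on E \<mu>"
    and nn': "\<forall>i\<in>E. 0 \<le> \<alpha> i \<and> 0 \<le> \<beta> i" and ab: "compatible a b"
    and pmf': "\<forall>S\<subseteq>E.
        pmf \<mu> S = (if s \<in> S then b else a) (card (S - {s})) * wt \<alpha> \<beta> (E - {s}) (S - {s})"
    using assms(1) unfolding almost_exchangeable_def by (elim conjE exE) (rule that)
  note nn = nn'[rule_format, THEN conjunct1] nn'[rule_format, THEN conjunct2] and pmf = pmf'[rule_format]
  let ?\<nu> = "map_pmf (\<lambda>T. T \<inter> (E - {x})) \<mu>"
  have on': "measure_on (E - {x}) ?\<nu>" by (auto simp: measure_on_def)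
  have \<nu>: "pmf ?\<nu> T = pmf \<mu> T + pmf \<mu> (insert x T)" if T: "T \<subseteq> E - {x}" for T
  proof -
    have "pmf ?\<nu> T = measure_pmf.prob \<mu> ((\<lambda>T. T \<inter> (E - {x})) -` {T})"
      by (simp add: pmf_map)
    also have "\<dots> = measure_pmf.prob \<mu> {T, insert x T}"
    proof (rule measure_pmf.finite_measure_eq_AE)
      have "(S \<in> (\<lambda>T. T \<inter> (E - {x})) -` {T}) = (S \<in> {T, insert x T})" if "S \<in> set_pmf \<mu>" for S
      proof -
        have "S \<subseteq> E" using that on by (auto simp: measure_on_def)
        then show ?thesis using T assms(2) by auto
      qed
      then show "AE S in measure_pmf \<mu>. (S \<in> (\<lambda>T. T \<inter> (E - {x})) -` {T}) = (S \<in> {T, insert x T})"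
        by (simp add: AE_measure_pmf_iff)
    qed auto
    also have "\<dots> = pmf \<mu> T + pmf \<mu> (insert x T)"
    proof -
      have "T \<noteq> insert x T" using T by auto
      then show ?thesis by (simp add: measure_measure_pmf_finite)
    qed
    finally show ?thesis .
  qed
  show ?thesis
  proof (cases "x = s")
    case True
    have "pmf ?\<nu> T = (if s \<in> T then (\<lambda>_. 0) else (\<lambda>k. a k + b k)) (card (T - {s}))
        * wt \<alpha> \<beta> (E - {x} - {s}) (T - {s})" if T: "T \<subseteq> E - {x}" for T
    proof -
      have "T \<subseteq> E" "insert x T \<subseteq> E" "s \<notin> T" "insert x T - {s} = T" "T - {s} = T" "E - {x} - {s} = E - {s}"
        using T True assms(2) by auto
      then show ?thesis using \<nu>[OF T] pmf[of T] pmf[of "insert x T"] True by (simp add: algebra_simps)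
    qed
    then show ?thesis
      unfolding almost_exchangeable_def
      using E on' nn compatible_merge[OF ab]
      by (intro conjI exI[of _ s] exI[of _ \<alpha>] exI[of _ \<beta>] exI[of _ "\<lambda>k. a k + b k"] exI[of _ "\<lambda>_. 0"]) auto
  next
    case False
    let ?a = "\<lambda>k. \<beta> x * a k + \<alpha> x * a (Suc k)" and ?b = "\<lambda>k. \<beta> x * b k + \<alpha> x * b (Suc k)"
    have "pmf ?\<nu> T = (if s \<in> T then ?b else ?a) (card (T - {s})) * wt \<alpha> \<beta> (E - {x} - {s}) (T - {s})"
      if T: "T \<subseteq> E - {x}" for T
    proof -
      have fin: "finite (E - {x} - {s})" "finite (T - {s})" using E T finite_subset by auto
      have "E - {s} = insert x (E - {x} - {s})" "insert x T - {s} = insert x (T - {s})"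
        "x \<notin> E - {x} - {s}" "x \<notin> T - {s}" "T - {s} \<subseteq> E - {x} - {s}" "s \<in> insert x T \<longleftrightarrow> s \<in> T"
        "T \<subseteq> E" "insert x T \<subseteq> E"
        using T False assms(2) by auto
      then show ?thesis
        using \<nu>[OF T] pmf[of T] pmf[of "insert x T"] wt_insert[OF fin(1), of x "T - {s}" \<alpha> \<beta>] fin(2)
        by (simp add: algebra_simps)
    qed
    then show ?thesis
      unfolding almost_exchangeable_def
      using E on' nn assms(2) compatible_project[OF ab, of "\<beta> x" "\<alpha> x"]
      by (intro conjI exI[of _ s] exI[of _ \<alpha>] exI[of _ \<beta>] exI[of _ ?a] exI[of _ ?b]) auto
  qed
qed

text \<open>The generating polynomial determines the measure, so \<open>\<nu>\<close> is the image
  of \<open>\<mu>\<close> under intersection with \<open>S\<close>, reached by removing coordinates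
  one at a time.\<close>

lemma almost_exchangeable_projection:
  assumes "almost_exchangeable E \<mu>" "is_projection E S \<mu> \<nu>"
  shows "almost_exchangeable S \<nu>"
proof -
  have E: "finite E" "measure_on E \<mu>" using assms(1) by (auto simp: almost_exchangeable_def)
  have S: "S \<subseteq> E" "measure_on S \<nu>" using assms(2) by (auto simp: is_projection_def)
  have \<nu>: "\<nu> = map_pmf (\<lambda>T. T \<inter> S) \<mu>"
    using is_projection_map_pmf[OF E S(1)] assms(2) S E finite_subset
    by (intro gen_poly_inject[of S]) (auto simp: is_projection_def)
  have "almost_exchangeable (E - D) (map_pmf (\<lambda>T. T \<inter> (E - D)) \<mu>)" if "finite D" "D \<subseteq> E" for D
    using that
  proof (induction D rule: finite_induct)
    case empty
    have "map_pmf (\<lambda>T. T \<inter> E) \<mu> = map_pmf (\<lambda>T. T) \<mu>"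
      using E(2) by (intro map_pmf_cong) (auto simp: measure_on_def)
    then show ?case using assms(1) by simp
  next
    case (insert x D)
    have "almost_exchangeable (E - D - {x})
        (map_pmf (\<lambda>T. T \<inter> (E - D - {x})) (map_pmf (\<lambda>T. T \<inter> (E - D)) \<mu>))"
      using insert by (intro almost_exchangeable_remove) auto
    moreover have "E - D - {x} = E - insert x D" by auto
    moreover have "(\<lambda>T. T \<inter> (E - D) \<inter> (E - insert x D)) = (\<lambda>T. T \<inter> (E - insert x D))" by auto
    ultimately show ?case by (simp add: map_pmf_comp)
  qed
  from this[of "E - S"] show ?thesis using E S \<nu> by (simp add: double_diff)
qed

lemma almost_exchangeable_obtained:
  assumes "obtained E \<mu> E' \<nu>" "almost_exchangeable E \<mu>"
  shows "almost_exchangeable E' \<nu>"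
  using assms
  by (induction rule: obtained.induct)
    (auto intro: almost_exchangeable_external_field almost_exchangeable_projection)

lemma almost_exchangeable_CNA_plus:
  assumes "almost_exchangeable E \<mu>"
  shows "CNA_plus E \<mu>"
  unfolding CNA_plus_def CNA_def
  using almost_exchangeable_obtained[OF _ assms]
  by (blast intro: almost_exchangeable_NA almost_exchangeable_cond)

subsection \<open>The Rayleigh property\<close>

lemma sum_Pow_remove:
  assumes "finite A" "i \<in> A"
  shows "(\<Sum>S\<in>Pow A. h S) = (\<Sum>S\<in>Pow (A - {i}). h S + h (insert i S))"
  using sum_Pow_insert[of "A - {i}" i h] assms by (simp add: insert_absorb)

text \<open>The operator x_i d/dx_i on a multiaffine polynomial: it keeps exactly the monomials that
  contain the variable.\<close>

lemma sum_Pow_containing: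
  fixes c :: "'a set \<Rightarrow> real"
  assumes "finite A" "i \<in> A"
  shows "x i * (\<Sum>S\<in>Pow (A - {i}). c (insert i S) * (\<Prod>k\<in>S. x k))
    = (\<Sum>S\<in>Pow A. c S * (\<Prod>k\<in>S. x k) * of_bool (i \<in> S))"
proof -
  have "(\<Sum>S\<in>Pow A. c S * (\<Prod>k\<in>S. x k) * of_bool (i \<in> S))
      = (\<Sum>S\<in>Pow (A - {i}). c S * (\<Prod>k\<in>S. x k) * of_bool (i \<in> S)
        + c (insert i S) * (\<Prod>k\<in>insert i S. x k) * of_bool (i \<in> insert i S))"
    by (rule sum_Pow_remove[OF assms])
  also have "\<dots> = (\<Sum>S\<in>Pow (A - {i}). x i * (c (insert i S) * (\<Prod>k\<in>S. x k)))"
  proof (intro sum.cong refl)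
    fix S assume "S \<in> Pow (A - {i})"
    then have "i \<notin> S" "finite S" using assms(1) finite_subset by auto
    then show "c S * (\<Prod>k\<in>S. x k) * of_bool (i \<in> S)
        + c (insert i S) * (\<Prod>k\<in>insert i S. x k) * of_bool (i \<in> insert i S)
        = x i * (c (insert i S) * (\<Prod>k\<in>S. x k))" by simp
  qed
  finally show ?thesis by (simp add: sum_distrib_left)
qed

lemma partial_deriv_multiaffine:
  fixes c :: "'a set \<Rightarrow> real"
  assumes "finite A"
  shows "partial_deriv i (\<lambda>z. \<Sum>S\<in>Pow A. c S * (\<Prod>k\<in>S. z k)) x
    = (if i \<in> A then \<Sum>S\<in>Pow (A - {i}). c (insert i S) * (\<Prod>k\<in>S. x k) else 0)"
proof -
  have unchanged: "(\<Prod>k\<in>S. (x(i := t)) k) = (\<Prod>k\<in>S. x k)" if "i \<notin> S" for S t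
    using that by (intro prod.cong) auto
  show ?thesis
  proof (cases "i \<in> A")
    case False
    then have "(\<lambda>t. \<Sum>S\<in>Pow A. c S * (\<Prod>k\<in>S. (x(i := t)) k)) = (\<lambda>t. \<Sum>S\<in>Pow A. c S * (\<Prod>k\<in>S. x k))"
      by (intro ext sum.cong refl) (subst unchanged, auto)
    then show ?thesis using False by (simp add: partial_deriv_def)
  next
    case True
    let ?P = "\<Sum>S\<in>Pow (A - {i}). c S * (\<Prod>k\<in>S. x k)"
    let ?Q = "\<Sum>S\<in>Pow (A - {i}). c (insert i S) * (\<Prod>k\<in>S. x k)"
    have "(\<lambda>t. \<Sum>S\<in>Pow A. c S * (\<Prod>k\<in>S. (x(i := t)) k)) = (\<lambda>t. ?P + t * ?Q)"
    proof
      fix t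
      have "(\<Sum>S\<in>Pow A. c S * (\<Prod>k\<in>S. (x(i := t)) k))
          = (\<Sum>S\<in>Pow (A - {i}). c S * (\<Prod>k\<in>S. (x(i := t)) k) + c (insert i S) * (\<Prod>k\<in>insert i S. (x(i := t)) k))"
        by (rule sum_Pow_remove[OF assms True])
      also have "\<dots> = (\<Sum>S\<in>Pow (A - {i}). c S * (\<Prod>k\<in>S. x k) + t * (c (insert i S) * (\<Prod>k\<in>S. x k)))"
      proof (intro sum.cong refl)
        fix S assume "S \<in> Pow (A - {i})"
        then have S: "i \<notin> S" "finite S" using assms finite_subset by auto
        then have "(\<Prod>k\<in>insert i S. (x(i := t)) k) = t * (\<Prod>k\<in>S. x k)"
          unfolding prod.insert[OF S(2,1)] unchanged[OF S(1)] by simp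
        then show "c S * (\<Prod>k\<in>S. (x(i := t)) k) + c (insert i S) * (\<Prod>k\<in>insert i S. (x(i := t)) k)
            = c S * (\<Prod>k\<in>S. x k) + t * (c (insert i S) * (\<Prod>k\<in>S. x k))"
          unfolding unchanged[OF S(1)] by simp
      qed
      finally show "(\<Sum>S\<in>Pow A. c S * (\<Prod>k\<in>S. (x(i := t)) k)) = ?P + t * ?Q"
        by (simp add: sum.distrib sum_distrib_left)
    qed
    moreover have "deriv (\<lambda>t. ?P + t * ?Q) (x i) = ?Q"
      by (rule DERIV_imp_deriv) (auto intro!: derivative_eq_intros)
    ultimately show ?thesis using True by (simp add: partial_deriv_def)
  qed
qed

lemma NA_of_CNA:
  assumes "CNA E \<mu>"
  shows "NA E \<mu>"
proof -
  have univ: "cond_event {} v = UNIV" for v by (simp add: cond_event_def)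
  have "cond_pmf \<mu> UNIV = \<mu>"
    by (intro pmf_eqI) (simp add: pmf_cond set_pmf_not_empty)
  then show ?thesis
    using assms univ unfolding CNA_def by (metis empty_subsetI measure_pmf.prob_space space_measure_pmf zero_less_one)
qed

text \<open>Under the field \<open>x\<close>, the expectations of X_i and X_i X_j are the first and
  second partial derivatives of the generating polynomial g at \<open>x\<close>, multiplied by x_i
  or x_i x_j and divided by g. Negative association of two coordinates is then the Rayleigh
  inequality up to a positive factor.\<close>

lemma CNA_plus_imp_Rayleigh:
  fixes E :: "'a set"
  assumes E: "finite E" "measure_on E \<mu>" and cna: "CNA_plus E \<mu>"
  shows "Rayleigh E \<mu>"
  unfolding Rayleigh_def
proof (intro allI impI ballI)
  fix x :: "'a \<Rightarrow> real" and i j assume x: "\<forall>i\<in>E. 0 < x i" and ij: "i \<in> E" "j \<in> E"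
  let ?g = "gen_poly E \<mu>"
  have g: "?g = (\<lambda>z. \<Sum>S\<in>Pow E. pmf \<mu> S * (\<Prod>k\<in>S. z k))"
    by (simp add: gen_poly_def fun_eq_iff)
  have d1: "partial_deriv k ?g = (\<lambda>z. \<Sum>S\<in>Pow (E - {k}). pmf \<mu> (insert k S) * (\<Prod>l\<in>S. z l))"
    if "k \<in> E" for k
    using that unfolding g by (intro ext) (simp add: partial_deriv_multiaffine[OF E(1)])
  have d2: "partial_deriv i (partial_deriv j ?g) x
      = (if i = j then 0 else \<Sum>S\<in>Pow (E - {j} - {i}). pmf \<mu> (insert j (insert i S)) * (\<Prod>l\<in>S. x l))"
    using ij E(1) unfolding d1[OF ij(2)] by (subst partial_deriv_multiaffine) auto
  show "partial_deriv i (partial_deriv j ?g) x * ?g x \<le> partial_deriv i ?g x * partial_deriv j ?g x"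
  proof (cases "i = j")
    \<comment> \<open>A multiaffine polynomial has vanishing pure second derivatives, so a square
      remains to be nonnegative.\<close>
    case True
    then show ?thesis unfolding d2 by simp
  next
    case False
    have pos: "0 < ?g x"
    proof -
      obtain S where "S \<in> set_pmf \<mu>" using set_pmf_not_empty[of \<mu>] by blast
      then have S: "S \<in> Pow E" "0 < pmf \<mu> S"
        using E(2) pmf_positive by (auto simp: measure_on_def)
      have pr: "0 < (\<Prod>k\<in>T. x k)" if "T \<in> Pow E" for T
        using that x by (intro prod_pos) auto
      show ?thesis
        unfolding gen_poly_def
        by (rule sum_pos2[OF _ S(1)]) (use E S pr in \<open>auto intro!: mult_nonneg_nonneg less_imp_le[OF pr]\<close>)
    qed
    then obtain \<nu> where \<nu>: "is_external_field E x \<mu> \<nu>"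
      using external_field_exists[OF E(1), of x \<mu>] x by (auto simp: less_imp_le)
    then have "NA E \<nu>"
      using cna obtained.external_field[OF obtained.base \<nu>] by (auto simp: CNA_plus_def intro: NA_of_CNA)
    have on: "measure_on E \<nu>" using \<nu> by (simp add: is_external_field_def)
    have ex: "measure_pmf.expectation \<nu> F = (\<Sum>S\<in>Pow E. pmf \<mu> S * (\<Prod>k\<in>S. x k) * F S) / ?g x" for F
      unfolding expectation_eq_sum[OF E(1) on] sum_divide_distrib
      by (intro sum.cong refl) (simp add: pmf_external_field[OF E(1) \<nu>])
    let ?X = "\<lambda>k S. of_bool (k \<in> S) :: real"
    have "measure_pmf.expectation \<nu> (\<lambda>S. ?X i S * ?X j S)
        \<le> measure_pmf.expectation \<nu> (?X i) * measure_pmf.expectation \<nu> (?X j)"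
    proof (rule \<open>NA E \<nu>\<close>[unfolded NA_def, rule_format, of _ _ "{i}" "{j}"])
      have "mono_on (Pow E) (?X k)" "depends_on E (?X k) {k}" for k
        by (auto simp: mono_on_def depends_on_def intro!: arg_cong[where f = of_bool])
      then show "mono_on (Pow E) (?X i) \<and> mono_on (Pow E) (?X j) \<and> {i} \<subseteq> E \<and> {j} \<subseteq> E \<and>
          {i} \<inter> {j} = {} \<and> depends_on E (?X i) {i} \<and> depends_on E (?X j) {j}"
        using ij False by simp
    qed
    moreover have "measure_pmf.expectation \<nu> (?X k) = x k * partial_deriv k ?g x / ?g x" if "k \<in> E" for k
      unfolding ex d1[OF that] sum_Pow_containing[OF E(1) that] ..
    moreover have "measure_pmf.expectation \<nu> (\<lambda>S. ?X i S * ?X j S)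
        = x i * x j * partial_deriv i (partial_deriv j ?g) x / ?g x"
    proof -
      have i: "i \<in> E - {j}" and fin: "finite (E - {j})" using ij False E(1) by auto
      have "x i * partial_deriv i (partial_deriv j ?g) x
          = (\<Sum>S\<in>Pow (E - {j}). pmf \<mu> (insert j S) * (\<Prod>k\<in>S. x k) * of_bool (i \<in> S))"
        using False unfolding d2 by (simp add: sum_Pow_containing[OF fin i, of x "\<lambda>S. pmf \<mu> (insert j S)"])
      also have "\<dots> = (\<Sum>S\<in>Pow (E - {j}). (pmf \<mu> (insert j S) * of_bool (i \<in> insert j S)) * (\<Prod>k\<in>S. x k))"
        using False by (intro sum.cong) auto
      finally have "x j * (x i * partial_deriv i (partial_deriv j ?g) x)
          = (\<Sum>S\<in>Pow E. (pmf \<mu> S * of_bool (i \<in> S)) * (\<Prod>k\<in>S. x k) * of_bool (j \<in> S))"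
        using sum_Pow_containing[OF E(1) ij(2), of x "\<lambda>S. pmf \<mu> S * of_bool (i \<in> S)"] by simp
      then show ?thesis unfolding ex by (simp add: ac_simps)
    qed
    ultimately have "x i * x j * partial_deriv i (partial_deriv j ?g) x / ?g x
        \<le> (x i * partial_deriv i ?g x / ?g x) * (x j * partial_deriv j ?g x / ?g x)"
      using ij by simp
    then have "(x i * x j) * (partial_deriv i (partial_deriv j ?g) x * ?g x)
        \<le> (x i * x j) * (partial_deriv i ?g x * partial_deriv j ?g x)"
      using pos by (simp add: divide_simps ac_simps split: if_splits)
    moreover have "0 < x i * x j" using x ij by simp
    ultimately show ?thesis by (simp only: mult_le_cancel_left_pos)
  qed
qed

subsection \<open>A measure that is not ultra log-concave\<close>

lemma pmf_from_weights:
  fixes f :: "'a set \<Rightarrow> real"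
  assumes "finite E" "\<And>S. S \<subseteq> E \<Longrightarrow> 0 \<le> f S" "T \<subseteq> E" "0 < f T"
  obtains \<mu> Z where "measure_on E \<mu>" "0 < Z" "\<And>S. S \<subseteq> E \<Longrightarrow> pmf \<mu> S = f S / Z"
proof -
  define Z where "Z = (\<Sum>S\<in>Pow E. f S)"
  have Z: "0 < Z" unfolding Z_def using assms by (intro sum_pos2[of _ T]) auto
  define h where "h S = (if S \<subseteq> E then f S / Z else 0)" for S
  have h: "0 \<le> h S" for S using assms(2) Z by (auto simp: h_def)
  have "(\<integral>\<^sup>+S. ennreal (h S) \<partial>count_space UNIV) = (\<Sum>S\<in>Pow E. ennreal (h S))"
    using assms(1) by (intro nn_integral_count_space') (auto simp: h_def)
  also have "\<dots> = ennreal (\<Sum>S\<in>Pow E. h S)" using h by (intro sum_ennreal) auto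
  also have "(\<Sum>S\<in>Pow E. h S) = (\<Sum>S\<in>Pow E. f S / Z)"
    by (intro sum.cong) (auto simp: h_def)
  also have "\<dots> = 1" using Z by (simp add: Z_def flip: sum_divide_distrib)
  finally have pmf: "pmf (embed_pmf h) S = h S" for S
    using h by (intro pmf_embed_pmf) auto
  show thesis
  proof (rule that[OF _ Z])
    show "measure_on E (embed_pmf h)"
      by (auto simp: measure_on_def set_pmf_iff pmf h_def split: if_splits)
    show "pmf (embed_pmf h) S = f S / Z" if "S \<subseteq> E" for S using that by (simp add: pmf h_def)
  qed
qed

lemma sum_card_eq:
  assumes "finite A"
  shows "(\<Sum>S\<in>Pow A. h (card S) * of_bool (card S = k)) = real (card A choose k) * h k"
proof -
  have "(\<Sum>S\<in>Pow A. h (card S) * of_bool (card S = k)) = (\<Sum>S\<in>{S. S \<subseteq> A \<and> card S = k}. h k)"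
    using assms by (intro sum.mono_neutral_cong_right) auto
  then show ?thesis using n_subsets[OF assms] by simp
qed

text \<open>With n = \<open>card E\<close>, the \<open>k\<close>-sets avoiding \<open>s\<close> and
  those containing it make up the fractions (n - k) / n and k / n of all
  \<open>k\<close>-sets.\<close>

lemma almost_exchangeable_rank_ratio:
  fixes a b :: "nat \<Rightarrow> real"
  assumes E: "finite E" "measure_on E \<mu>" "s \<in> E"
    and pmf: "\<And>S. S \<subseteq> E \<Longrightarrow> pmf \<mu> S = (if s \<in> S then b else a) (card (S - {s}))"
    and k: "1 \<le> k" "k \<le> card E"
  shows "rank_seq E \<mu> k / real (card E choose k)
    = ((real (card E) - real k) * a k + real k * b (k - 1)) / real (card E)"
proof -
  define A where "A = E - {s}"
  define n where "n = card E"
  have A: "finite A" "s \<notin> A" "E = insert s A" "card A = n - 1" using E by (auto simp: A_def n_def)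
  have n: "1 \<le> n" "k \<le> n" using k by (auto simp: n_def)
  have "rank_seq E \<mu> k = (\<Sum>S\<in>{S. S \<subseteq> E \<and> card S = k}. pmf \<mu> S)"
    unfolding rank_seq_def using E(1) by (intro measure_measure_pmf_finite) auto
  also have "\<dots> = (\<Sum>S\<in>Pow (insert s A). pmf \<mu> S * of_bool (card S = k))"
    using E(1) A(3) by (intro sum.mono_neutral_cong_left) auto
  also have "\<dots> = (\<Sum>S\<in>Pow A. pmf \<mu> S * of_bool (card S = k)
      + pmf \<mu> (insert s S) * of_bool (card (insert s S) = k))"
    by (rule sum_Pow_insert[OF A(1,2)])
  also have "\<dots> = (\<Sum>S\<in>Pow A. a (card S) * of_bool (card S = k) + b (card S) * of_bool (card S = k - 1))"
  proof (intro sum.cong refl)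
    fix S assume "S \<in> Pow A"
    then have S: "S \<subseteq> E" "insert s S \<subseteq> E" "s \<notin> S" "finite S" "insert s S - {s} = S" "S - {s} = S"
      using A finite_subset by auto
    moreover have "Suc (card S) = k \<longleftrightarrow> card S = k - 1" using k(1) by auto
    ultimately show "pmf \<mu> S * of_bool (card S = k) + pmf \<mu> (insert s S) * of_bool (card (insert s S) = k)
        = a (card S) * of_bool (card S = k) + b (card S) * of_bool (card S = k - 1)"
      using pmf[OF S(1)] pmf[OF S(2)] by simp
  qed
  also have "\<dots> = real ((n - 1) choose k) * a k + real ((n - 1) choose (k - 1)) * b (k - 1)"
    unfolding sum.distrib sum_card_eq[OF A(1)] A(4) ..
  finally have r: "rank_seq E \<mu> k = real ((n - 1) choose k) * a k + real ((n - 1) choose (k - 1)) * b (k - 1)" .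
  have "real ((n - k) * (n choose k)) = real (n * ((n - 1) choose k))"
    by (simp only: binomial_absorb_comp)
  then have 1: "real ((n - 1) choose k) = (real n - real k) * real (n choose k) / real n"
    using n by (simp add: of_nat_diff field_simps)
  have "real (k * (n choose k)) = real (n * ((n - 1) choose (k - 1)))"
    using k by (subst times_binomial_minus1_eq) auto
  then have 2: "real ((n - 1) choose (k - 1)) = real k * real (n choose k) / real n"
    using n by (simp add: field_simps)
  have "0 < n choose k" using n by simp
  then show ?thesis
    unfolding r 1 2 n_def[symmetric] using n by (simp add: field_simps)
qed

text \<open>From \<open>K\<close> on, a combination takes the values 2y, x + 2y, 2x + 2y, 4x and is
  zero elsewhere. The three nontrivial inequalities have slack x^2, 2x^2 - 2xy + 4y^2 and
  4y^2.\<close>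

lemma compatible_example:
  fixes K :: nat
  defines "a \<equiv> \<lambda>j. if j = K + 1 then 1 else if j = K + 2 then 2 else if j = K + 3 then 4 else 0"
    and "b \<equiv> \<lambda>j. if j = K \<or> j = K + 1 \<or> j = K + 2 then 2 else 0"
  shows "compatible a b"
  unfolding compatible_def
proof (intro conjI allI impI)
  fix x y :: real assume xy: "0 \<le> x" "0 \<le> y"
  define c where "c k = x * a k + y * b k" for k
  have c: "c K = 2 * y" "c (K + 1) = x + 2 * y" "c (K + 2) = 2 * x + 2 * y" "c (K + 3) = 4 * x"
    by (simp_all add: c_def a_def b_def)
  have c0: "c k = 0" if "k \<noteq> K" "k \<noteq> K + 1" "k \<noteq> K + 2" "k \<noteq> K + 3" for k
    using that by (simp add: c_def a_def b_def)
  have nn: "0 \<le> c k" for k using xy by (simp add: c_def a_def b_def)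
  have "c k * c (Suc l) \<le> c (Suc k) * c l" if "k \<le> l" for k l
  proof (cases "k = l \<or> c k = 0 \<or> c (Suc l) = 0")
    case True
    then show ?thesis
    proof (elim disjE)
      assume "k = l" then show ?thesis by (simp add: mult.commute)
    qed (use nn in auto)
  next
    case False
    have "K \<le> k" using c0[of k] False by (cases "K \<le> k") simp_all
    moreover have "l \<le> K + 2" using c0[of "Suc l"] False by (cases "l \<le> K + 2") simp_all
    moreover have "k < l" using False \<open>k \<le> l\<close> by simp
    ultimately consider "k = K" "l = K + 1" | "k = K" "l = K + 2" | "k = K + 1" "l = K + 2"
      by linarith
    then show ?thesis
    proof cases
      case 1
      have "(2 * y) * (2 * x + 2 * y) \<le> (x + 2 * y) * (x + 2 * y)" by (simp add: algebra_simps)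
      then show ?thesis using 1 c by (simp add: numeral_2_eq_2)
    next
      case 2
      have "0 \<le> (x - y)\<^sup>2 + x\<^sup>2 + 3 * y\<^sup>2" by simp
      then have "(2 * y) * (4 * x) \<le> (x + 2 * y) * (2 * x + 2 * y)"
        by (simp add: algebra_simps power2_eq_square)
      then show ?thesis using 2 c by (simp add: numeral_3_eq_3 numeral_2_eq_2)
    next
      case 3
      have "(x + 2 * y) * (4 * x) \<le> (2 * x + 2 * y) * (2 * x + 2 * y)" by (simp add: algebra_simps)
      then show ?thesis using 3 c by (simp add: numeral_3_eq_3 numeral_2_eq_2)
    qed
  qed
  then show "strongly_lc (\<lambda>k. x * a k + y * b k)"
    using nn by (simp add: strongly_lc_def c_def)
next
  fix k l :: nat assume "k \<le> l"
  then show "a k * b l \<le> a l * b k" by (auto simp: a_def b_def)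
qed

theorem mainTheorem9:
  fixes n :: nat
  assumes "n \<ge> 20"
  shows "\<exists>\<mu> :: nat set pmf. measure_on {1..n} \<mu> \<and>
           CNA_plus {1..n} \<mu> \<and> Rayleigh {1..n} \<mu> \<and> \<not> ULC {1..n} \<mu>"
proof -
  define k where "k = n div 2"
  \<comment> \<open>This offset puts the values 1, 2, 4 of \<open>a\<close> at \<open>k - 1\<close>,
    \<open>k\<close>, \<open>k + 1\<close> and the support of \<open>b\<close> at
    \<open>k - 2\<close>, \<open>k - 1\<close>, \<open>k\<close>.\<close>
  define K where "K = k - 2"
  have k: "10 \<le> k" "k = K + 2" "n = 2 * k \<or> n = 2 * k + 1"
    using assms by (auto simp: k_def K_def)
  define a b :: "nat \<Rightarrow> real"
    where "a = (\<lambda>j. if j = K + 1 then 1 else if j = K + 2 then 2 else if j = K + 3 then 4 else 0)"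
      and "b = (\<lambda>j. if j = K \<or> j = K + 1 \<or> j = K + 2 then 2 else 0)"
  have ab: "compatible a b" unfolding a_def b_def by (rule compatible_example)
  let ?E = "{1..n}"
  let ?w = "\<lambda>S. (if n \<in> S then b else a) (card (S - {n}))"
  obtain \<mu> Z where \<mu>: "measure_on ?E \<mu>" and Z: "0 < Z"
    and pmf: "\<And>S. S \<subseteq> ?E \<Longrightarrow> pmf \<mu> S = ?w S / Z"
  proof (rule pmf_from_weights[of ?E ?w "{1..K + 1}"])
    show "0 \<le> ?w S" for S by (simp add: a_def b_def)
    \<comment> \<open>A set of size \<open>K + 1\<close> avoiding the special element
      \<open>n\<close> has weight 1, so the total weight is positive.\<close>
    have "n \<notin> {1..K + 1}" "{1..K + 1} - {n} = {1..K + 1}" using k by auto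
    then have "?w {1..K + 1} = a (card {1..K + 1})" by (simp only: if_False)
    then show "0 < ?w {1..K + 1}" by (simp add: a_def)
  qed (use k in auto)
  let ?a = "\<lambda>j. (1 / Z) * a j" and ?b = "\<lambda>j. (1 / Z) * b j"
  have pmf': "pmf \<mu> S = (if n \<in> S then ?b else ?a) (card (S - {n}))" if "S \<subseteq> ?E" for S
    using pmf[OF that] by simp
  have ae: "almost_exchangeable ?E \<mu>"
    unfolding almost_exchangeable_def
    using \<mu> compatible_scale[OF ab, of "1 / Z" "1 / Z"] Z pmf'
    by (intro conjI exI[of _ n] exI[of _ "\<lambda>_. 1"] exI[of _ ?a] exI[of _ ?b]) (auto simp: wt_def)
  define u where "u j = rank_seq ?E \<mu> j / real (card ?E choose j)" for j
  have u: "u j = ((real n - real j) * a j + real j * b (j - 1)) / (Z * real n)" if "1 \<le> j" "j \<le> n" for j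
    unfolding u_def
    using almost_exchangeable_rank_ratio[OF _ \<mu> _ pmf', of j] that k Z
    by (simp add: field_simps)
  have uk: "u k = 2 * real n / (Z * real n)"
    and uk1: "u (k + 1) = (4 * real n - 2 * real k - 2) / (Z * real n)"
    and uk': "u (k - 1) = (real n + real k - 1) / (Z * real n)"
    using k u[of k] u[of "k + 1"] u[of "k - 1"] by (auto simp: a_def b_def algebra_simps)
  \<comment> \<open>To leading order the sides are 16k^2 and 18k^2. The exact gap is 2k^2 - 12k + 2
    for even and 2k^2 - 10k - 4 for odd \<open>n\<close>, positive since k^2 \<ge> 10k.\<close>
  have "(2 * real n)\<^sup>2 < (real n + real k - 1) * (4 * real n - 2 * real k - 2)"
  proof -
    have k10: "10 \<le> real k" using k by simp
    then have sq: "10 * real k \<le> real k * real k" by (intro mult_right_mono) auto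
    from k(3) show ?thesis
    proof
      assume "n = 2 * k"
      then have n: "real n = 2 * real k" by simp
      have "(real n + real k - 1) * (4 * real n - 2 * real k - 2) - (2 * real n)\<^sup>2
          = 2 * (real k * real k) - 12 * real k + 2"
        unfolding n by (simp add: power2_eq_square algebra_simps)
      then show ?thesis using k10 sq by linarith
    next
      assume "n = 2 * k + 1"
      then have n: "real n = 2 * real k + 1" by simp
      have "(real n + real k - 1) * (4 * real n - 2 * real k - 2) - (2 * real n)\<^sup>2
          = 2 * (real k * real k) - 10 * real k - 4"
        unfolding n by (simp add: power2_eq_square algebra_simps)
      then show ?thesis using k10 sq by linarith
    qed
  qed
  then have "(2 * real n)\<^sup>2 / (Z * real n)\<^sup>2
      < ((real n + real k - 1) * (4 * real n - 2 * real k - 2)) / (Z * real n)\<^sup>2"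
    using Z k by (intro divide_strict_right_mono) auto
  then have "(u k)\<^sup>2 < u (k - 1) * u (k + 1)"
    unfolding uk uk1 uk' by (simp only: power_divide power2_eq_square times_divide_times_eq)
  moreover have "1 \<le> k" "k + 1 \<le> card ?E" using k by auto
  ultimately have "\<not> ULC ?E \<mu>"
    unfolding ULC_def log_concave_seq_def u_def[symmetric] by (meson not_le)
  moreover have "CNA_plus ?E \<mu>" using almost_exchangeable_CNA_plus[OF ae] .
  ultimately show ?thesis
    using \<mu> CNA_plus_imp_Rayleigh[OF _ \<mu>] by blast
qed

end
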